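(* Let $\mathcal{A}$ be a C*-algebra and let $x \in \mathcal{A}$ with $\|x\| = 1$. Then $x$ is unitary if and only if $S_x$ spans $\mathcal{A}^*$, where $S_x = \{f \in \mathcal{A}^* : f(x) = \|f\| = 1\}$.
   Context: C*-algebras are complex, and $\mathcal{A}$ is not assumed to be unital; the assertion that $x$ is unitary means that $\mathcal{A}$ has a unit $1$ and $x^*x = xx^* = 1$. $\mathcal{A}^*$ denotes the dual Banach space of $\mathcal{A}$ (bounded complex-linear functionals). "Spans" refers to the complex linear span (finite linear combinations). *)

theory Defs
  imports "HOL-Analysis.Analysis"
begin

class complex_vector = real_vector +
  fixes scaleC :: "complex \<Rightarrow> 'a \<Rightarrow> 'a" (infixr "*\<^sub>C" 75)
  assumes scaleC_add_right: "c *\<^sub>C (x + y) = c *\<^sub>C x + c *\<^sub>C y"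
    and scaleC_add_left: "(c + d) *\<^sub>C x = c *\<^sub>C x + d *\<^sub>C x"
    and scaleC_scaleC: "c *\<^sub>C (d *\<^sub>C x) = (c * d) *\<^sub>C x"
    and scaleC_one: "1 *\<^sub>C x = x"
    and scaleR_scaleC: "r *\<^sub>R x = complex_of_real r *\<^sub>C x"

class complex_normed_vector = complex_vector + real_normed_vector +
  assumes norm_scaleC: "norm (c *\<^sub>C x) = cmod c * norm x"

(* The class real_normed_algebra does not provide a unit. *)
class cstar_algebra = complex_normed_vector + real_normed_algebra + complete_space +
  fixes adj :: "'a \<Rightarrow> 'a"
  assumes mult_scaleC_left: "(c *\<^sub>C x) * y = c *\<^sub>C (x * y)"
    and mult_scaleC_right: "x * (c *\<^sub>C y) = c *\<^sub>C (x * y)"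
    and adj_adj: "adj (adj x) = x"
    and adj_add: "adj (x + y) = adj x + adj y"
    and adj_scaleC: "adj (c *\<^sub>C x) = cnj c *\<^sub>C adj x"
    and adj_mult: "adj (x * y) = adj y * adj x"
    and cstar_identity: "norm (adj x * x) = (norm x)\<^sup>2"

global_interpretation complex_vector:
  vector_space "scaleC :: complex \<Rightarrow> 'a \<Rightarrow> 'a::complex_vector"
  by unfold_locales (simp_all add: scaleC_add_right scaleC_add_left scaleC_scaleC scaleC_one)

instantiation complex :: cstar_algebra
begin

definition scaleC_complex :: "complex \<Rightarrow> complex \<Rightarrow> complex"
  where "scaleC_complex c z = c * z"

definition adj_complex :: "complex \<Rightarrow> complex"
  where "adj_complex = cnj"

instance
  by standard
    (simp_all add: scaleC_complex_def adj_complex_def algebra_simps scaleR_conv_of_real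
      norm_mult power2_eq_square)

end

lemma bounded_linear_scaleC:
  "bounded_linear (\<lambda>x::'a::complex_normed_vector. c *\<^sub>C x)"
proof (rule bounded_linear_intro[where K = "cmod c"])
  show "c *\<^sub>C (x + y) = c *\<^sub>C x + c *\<^sub>C y" for x y :: 'a
    by (rule scaleC_add_right)
  show "c *\<^sub>C (r *\<^sub>R x) = r *\<^sub>R (c *\<^sub>C x)" for r and x :: 'a
    by (simp add: scaleR_scaleC scaleC_scaleC mult.commute)
  show "norm (c *\<^sub>C x) \<le> norm x * cmod c" for x :: 'a
    by (simp add: norm_scaleC)
qed

(* Complex scalars act pointwise on the real-linear maps into a complex normed space. *)
instantiation blinfun :: (real_normed_vector, complex_normed_vector) complex_vector
begin

lift_definition scaleC_blinfun :: "complex \<Rightarrow> 'a \<Rightarrow>\<^sub>L 'b \<Rightarrow> 'a \<Rightarrow>\<^sub>L 'b"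
  is "\<lambda>c f x. c *\<^sub>C f x"
  by (rule bounded_linear_compose[OF bounded_linear_scaleC])

instance
  by standard
    (transfer, simp add: scaleC_add_right scaleC_add_left scaleC_scaleC scaleC_one scaleR_scaleC)+

end

(* The type of blinfun consists of the real-linear bounded maps, so complex homogeneity is
   imposed separately.  The norm of blinfun is the operator norm, hence the dual norm here. *)
definition complex_dual :: "('a::complex_normed_vector \<Rightarrow>\<^sub>L complex) set"
  where "complex_dual = {f. \<forall>c x. blinfun_apply f (c *\<^sub>C x) = c * blinfun_apply f x}"

definition norming_functionals ::
    "'a::complex_normed_vector \<Rightarrow> ('a \<Rightarrow>\<^sub>L complex) set"
  where "norming_functionals x =
    {f \<in> complex_dual. blinfun_apply f x = complex_of_real (norm f) \<and> norm f = 1}"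

definition is_unit_element :: "'a::cstar_algebra \<Rightarrow> bool"
  where "is_unit_element e \<longleftrightarrow> (\<forall>a. e * a = a \<and> a * e = a)"

definition unitary :: "'a::cstar_algebra \<Rightarrow> bool"
  where "unitary x \<longleftrightarrow> (\<exists>e. is_unit_element e \<and> adj x * x = e \<and> x * adj x = e)"

end

theory Submission
  imports Defs
begin

text \<open>If \<open>f\<close> norms \<open>x\<close>, then \<open>f\<close> vanishes on each \<open>d\<close> with \<open>norm (x + c d) \<le> 1 + O(\<bar>c\<bar>\<^sup>2)\<close>. Both
  \<open>a - x x\<^sup>* a\<close> and \<open>a - a x\<^sup>* x\<close> are such directions, so if the norming functionals span the dual,
  these elements are \<open>0\<close> for all \<open>a\<close>, and \<open>x x\<^sup>* = x\<^sup>* x\<close> is a unit. The norm estimate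
  is a positivity statement in the unitization.
  Conversely, translation by \<open>x\<^sup>*\<close> reduces the case of a unitary \<open>x\<close> to that of the unit, whose norming
  functionals are the states; a real functional is a difference of two positive ones by
  Hahn--Banach. Positivity of \<open>a\<close> is expressed by \<open>norm (s - a) \<le> s\<close> for some \<open>s \<ge> 0\<close>, and square roots come
  from an iteration, so that no spectral theory is needed.\<close>

text \<open>The estimate involves \<open>1 - x * adj x\<close>, but the algebra need not contain
  \<open>1\<close>. The directions \<open>a - x * adj x * a\<close> do lie in it, so only the
  estimate itself moves to the unitization. There the terms of first order are cancelled by adding a
  suitable \<open>adj y * y\<close>, so everything rests on \<open>pos_adj_mult_self\<close>. The
  usual proof of that fact compares the spectra of \<open>adj w * w\<close> and
  \<open>w * adj w\<close>; here a norm estimate for a cubic polynomial takes the place of the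
  comparison. For hermitian \<open>a\<close>, the condition \<open>norm (s - a) \<le> s\<close> says
  that the spectrum lies in \<open>[0, 2 s]\<close>, and it makes closure under sums a triangle
  inequality. The commutation properties recorded by \<open>sqrt_one_minus\<close> and
  \<open>pos_sqrt\<close> stand in for functional calculus.\<close>

section \<open>Elementary properties of the involution\<close>

lemma scaleC_diff_right: "c *\<^sub>C (x - y) = c *\<^sub>C x - c *\<^sub>C (y::'a::complex_vector)"
  by (rule complex_vector.scale_right_diff_distrib)

lemma adj_scaleR [simp]: "adj (r *\<^sub>R x) = r *\<^sub>R adj (x::'a::cstar_algebra)"
  by (simp add: scaleR_scaleC adj_scaleC)

lemma adj_zero [simp]: "adj 0 = (0::'a::cstar_algebra)"
  using adj_scaleR[of 0 "0::'a"] by simp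

lemma adj_minus [simp]: "adj (- x) = - adj (x::'a::cstar_algebra)"
  using adj_scaleR[of "-1" x] by simp

lemma adj_diff [simp]: "adj (x - y) = adj x - adj (y::'a::cstar_algebra)"
  using adj_add[of x "- y"] by simp

lemmas adj_simps [simp] = adj_adj adj_add adj_mult

lemma norm_adj [simp]: "norm (adj x) = norm (x::'a::cstar_algebra)"
proof -
  have le: "norm y \<le> norm (adj y)" for y :: 'a
  proof (cases "y = 0")
    case False
    have "norm y * norm y \<le> norm (adj y) * norm y"
      using norm_mult_ineq[of "adj y" y] by (simp add: cstar_identity power2_eq_square)
    then show ?thesis using False by simp
  qed simp
  show ?thesis using le[of x] le[of "adj x"] by simp
qed

lemma cstar_identity': "norm (x * adj x) = (norm (x::'a::cstar_algebra))\<^sup>2"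
  using cstar_identity[of "adj x"] by simp

lemma norm_square_hermitian: "adj a = a \<Longrightarrow> norm (a * a) = (norm (a::'a::cstar_algebra))\<^sup>2"
  using cstar_identity[of a] by simp

lemma bounded_linear_adj: "bounded_linear (adj :: 'a::cstar_algebra \<Rightarrow> 'a)"
  by (rule bounded_linear_intro[where K = 1]) simp_all

section \<open>Square roots of \<open>1 - d\<close>\<close>

text \<open>A fixed point \<open>b = (d + b * b) / 2\<close> satisfies
  \<open>(1 - b)^2 = 1 - d\<close>. Iterating towards \<open>b\<close> instead of the root
  \<open>1 - b\<close> makes sense without a unit.\<close>

primrec sqrt_iter :: "'a::real_algebra \<Rightarrow> nat \<Rightarrow> 'a" where
  "sqrt_iter d 0 = 0"
| "sqrt_iter d (Suc n) = (1/2) *\<^sub>R (d + sqrt_iter d n * sqrt_iter d n)"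

lemma sqrt_iter_commute: "c * d = d * c \<Longrightarrow> c * sqrt_iter d n = sqrt_iter d n * c"
proof (induction n)
  case (Suc n)
  have "c * (sqrt_iter d n * sqrt_iter d n) = sqrt_iter d n * sqrt_iter d n * c"
    using Suc by (metis mult.assoc)
  then show ?case using Suc by (simp add: distrib_left distrib_right)
qed simp

lemma sqrt_iter_real: "0 \<le> sqrt_iter (1::real) n" "sqrt_iter (1::real) n \<le> 1"
    "sqrt_iter (1::real) n \<le> sqrt_iter 1 (Suc n)"
proof -
  show a: "0 \<le> sqrt_iter (1::real) n" for n by (induction n) simp_all
  show "sqrt_iter (1::real) n \<le> 1" 
  proof (induction n)
    case (Suc n) then show ?case using mult_le_one[OF Suc a Suc] by simp
  qed simp
  show "sqrt_iter (1::real) n \<le> sqrt_iter 1 (Suc n)"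
  proof -
    have "0 \<le> (1 - sqrt_iter (1::real) n)\<^sup>2" by simp
    then show ?thesis by (simp add: power2_eq_square algebra_simps)
  qed
qed

text \<open>Scalar majorization by the case \<open>d = 1\<close> gives convergence even for \<open>norm d = 1\<close>.\<close>

lemma sqrt_iter_majorized:
  fixes d :: "'a::real_normed_algebra"
  assumes "norm d \<le> 1"
  shows "norm (sqrt_iter d n) \<le> sqrt_iter 1 n"
    and "norm (sqrt_iter d (Suc n) - sqrt_iter d n) \<le> sqrt_iter 1 (Suc n) - sqrt_iter 1 n"
proof -
  show bd: "norm (sqrt_iter d n) \<le> sqrt_iter 1 n" for n
  proof (induction n)
    case (Suc n)
    have "norm (sqrt_iter d n * sqrt_iter d n) \<le> sqrt_iter 1 n * sqrt_iter 1 n"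
      using norm_mult_ineq mult_mono'[OF Suc Suc] order_trans norm_ge_zero by metis
    then show ?case 
      using norm_triangle_ineq[of d "sqrt_iter d n * sqrt_iter d n"] assms by simp
  qed simp
  show "norm (sqrt_iter d (Suc n) - sqrt_iter d n) \<le> sqrt_iter 1 (Suc n) - sqrt_iter 1 n"
  proof (induction n)
    case 0 then show ?case using assms by simp
  next
    case (Suc n)
    define b c where "b = sqrt_iter d (Suc n)" and "c = sqrt_iter d n"
    define \<beta> \<gamma> :: real where "\<beta> = sqrt_iter 1 (Suc n)" and "\<gamma> = sqrt_iter 1 n"
    have comm: "b * c = c * b"
      unfolding b_def c_def by (intro sqrt_iter_commute sqrt_iter_commute[symmetric]) simp
    have "sqrt_iter d (Suc (Suc n)) - sqrt_iter d (Suc n) = (1/2) *\<^sub>R (b * b - c * c)"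
      unfolding b_def c_def by (simp add: algebra_simps)
    also have "b * b - c * c = (b - c) * (b + c)"
      using comm by (simp add: algebra_simps)
    finally have eq: "sqrt_iter d (Suc (Suc n)) - sqrt_iter d (Suc n) = (1/2) *\<^sub>R ((b - c) * (b + c))" .
    have "norm ((b - c) * (b + c)) \<le> norm (b - c) * norm (b + c)" by (rule norm_mult_ineq)
    also have "\<dots> \<le> (\<beta> - \<gamma>) * (\<beta> + \<gamma>)"
    proof (rule mult_mono)
      show "norm (b - c) \<le> \<beta> - \<gamma>" using Suc unfolding b_def c_def \<beta>_def \<gamma>_def .
      show "norm (b + c) \<le> \<beta> + \<gamma>" 
        using norm_triangle_ineq[of b c] bd[of n] bd[of "Suc n"] 
        unfolding b_def c_def \<beta>_def \<gamma>_def by linarith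
      show "0 \<le> \<beta> - \<gamma>" using sqrt_iter_real(3)[of n] unfolding \<beta>_def \<gamma>_def by linarith
    qed simp
    finally have "norm (sqrt_iter d (Suc (Suc n)) - sqrt_iter d (Suc n)) \<le> (1/2) * ((\<beta> - \<gamma>) * (\<beta> + \<gamma>))"
      unfolding eq by simp
    also have "\<dots> = sqrt_iter 1 (Suc (Suc n)) - sqrt_iter 1 (Suc n)"
      unfolding \<beta>_def \<gamma>_def by (simp add: algebra_simps)
    finally show ?case .
  qed
qed

lemma sqrt_iter_convergent:
  fixes d :: "'a::{real_normed_algebra, complete_space}"
  assumes "norm d \<le> 1"
  shows "convergent (sqrt_iter d)"
proof -
  have "incseq (sqrt_iter (1::real))" by (intro incseq_SucI sqrt_iter_real(3))
  moreover have "Bseq (sqrt_iter (1::real))"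
    by (rule BseqI'[of _ 1]) (simp add: sqrt_iter_real)
  ultimately have "convergent (sqrt_iter (1::real))"
    by (intro Bseq_monoseq_convergent) (auto simp: monoseq_iff)
  then have "summable (\<lambda>n. sqrt_iter (1::real) (Suc n) - sqrt_iter 1 n)"
    using telescope_summable convergent_LIMSEQ_iff by blast
  then have sm: "summable (\<lambda>n. norm (sqrt_iter d (Suc n) - sqrt_iter d n))"
    by (rule summable_comparison_test')
       (use sqrt_iter_majorized(2)[OF assms] in \<open>simp del: sqrt_iter.simps\<close>)
  have "Cauchy (sqrt_iter d)"
  proof (rule metric_CauchyI)
    fix \<epsilon> :: real assume "0 < \<epsilon>"
    then obtain M where M: "\<And>m n. m \<ge> M \<Longrightarrow> norm (sum (\<lambda>n. norm (sqrt_iter d (Suc n) - sqrt_iter d n)) {m..<n}) < \<epsilon>"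
      using sm unfolding summable_Cauchy by blast
    have lt: "dist (sqrt_iter d n) (sqrt_iter d m) < \<epsilon>" if "M \<le> m" "m \<le> n" for m n
    proof -
      have "sqrt_iter d n - sqrt_iter d m = (\<Sum>k=m..<n. sqrt_iter d (Suc k) - sqrt_iter d k)"
        using sum_Suc_diff'[of m n "sqrt_iter d"] that by simp
      then have "dist (sqrt_iter d n) (sqrt_iter d m) \<le> (\<Sum>k=m..<n. norm (sqrt_iter d (Suc k) - sqrt_iter d k))"
        unfolding dist_norm using norm_sum by metis
      also have "\<dots> < \<epsilon>" by (rule order.strict_trans1[OF abs_ge_self M[OF that(1), of n, unfolded real_norm_def]])
      finally show ?thesis .
    qed
    show "\<exists>M. \<forall>m\<ge>M. \<forall>n\<ge>M. dist (sqrt_iter d m) (sqrt_iter d n) < \<epsilon>"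
      using lt by (metis dist_commute nle_le)
  qed
  then show ?thesis by (rule Cauchy_convergent)
qed

text \<open>The root is \<open>1 - b\<close>: the equation for \<open>b * b\<close> is
  \<open>(1 - b)^2 = 1 - d\<close> with the unit removed. All four properties pass from the iterates
  to their limit.\<close>

lemma sqrt_one_minus:
  fixes d :: "'a::cstar_algebra"
  assumes d: "adj d = d" "norm d \<le> 1"
  obtains b where "adj b = b" "norm b \<le> 1" "b * b = 2 *\<^sub>R b - d"
    "\<And>c. c * d = d * c \<Longrightarrow> c * b = b * c"
proof -
  obtain b where lim: "sqrt_iter d \<longlonglongrightarrow> b"
    using sqrt_iter_convergent[OF d(2)] unfolding convergent_def by blast
  have herm: "adj (sqrt_iter d n) = sqrt_iter d n" for n
    by (induction n) (simp_all add: d)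
  have "(\<lambda>n. adj (sqrt_iter d n)) \<longlonglongrightarrow> adj b"
    by (rule bounded_linear.tendsto[OF bounded_linear_adj lim])
  then have "adj b = b" using lim herm LIMSEQ_unique by simp
  moreover have "norm b \<le> 1"
    using tendsto_norm[OF lim]
    by (rule LIMSEQ_le_const2) 
       (use sqrt_iter_majorized(1)[OF d(2)] sqrt_iter_real(2) order_trans in blast)
  moreover have "b * b = 2 *\<^sub>R b - d"
  proof -
    have "(\<lambda>n. (1/2) *\<^sub>R (d + sqrt_iter d n * sqrt_iter d n)) \<longlonglongrightarrow> (1/2) *\<^sub>R (d + b * b)"
      by (intro tendsto_intros lim)
    moreover have "(\<lambda>n. sqrt_iter d (Suc n)) \<longlonglongrightarrow> b" by (rule LIMSEQ_Suc[OF lim])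
    ultimately have "b = (1/2) *\<^sub>R (d + b * b)" using LIMSEQ_unique by simp
    then have "2 *\<^sub>R b = 2 *\<^sub>R ((1/2) *\<^sub>R (d + b * b))" by simp
    then show ?thesis by simp
  qed
  moreover have "c * b = b * c" if "c * d = d * c" for c
  proof -
    have "(\<lambda>n. c * sqrt_iter d n) \<longlonglongrightarrow> c * b" "(\<lambda>n. sqrt_iter d n * c) \<longlonglongrightarrow> b * c"
      by (intro tendsto_intros lim)+
    then show ?thesis using sqrt_iter_commute[OF that] LIMSEQ_unique by simp
  qed
  ultimately show ?thesis using that by blast
qed

section \<open>Positive elements\<close>

text \<open>The last conclusion exhibits \<open>adj y * y + y * adj y\<close> as a sum of hermitian
  squares, hence as positive, before \<open>adj y * y\<close> alone is known to be so.\<close>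

lemma cartesian_decomposition:
  fixes y :: "'a::cstar_algebra"
  obtains a b where "adj a = a" "adj b = b" "y = a + \<i> *\<^sub>C b" 
    "adj y * y + y * adj y = 2 *\<^sub>R (a * a + b * b)"
proof -
  define a where "a = (1/2) *\<^sub>R (y + adj y)"
  define b where "b = (\<i>/2) *\<^sub>C (adj y - y)"
  have ha: "adj a = a" by (simp add: a_def add.commute)
  have hb: "adj b = b" by (simp add: b_def adj_scaleC scaleC_diff_right complex_vector.scale_minus_left)
  have "\<i> *\<^sub>C b = (1/2) *\<^sub>R (y - adj y)"
    by (simp add: b_def scaleC_scaleC scaleR_scaleC scaleC_diff_right complex_vector.scale_minus_left)
  then have y: "y = a + \<i> *\<^sub>C b"
    by (simp add: a_def flip: scaleR_add_right)
  have "adj y * y + y * adj y = 2 *\<^sub>R (a * a + b * b)"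
    unfolding y 
    by (simp add: ha hb adj_scaleC mult_scaleC_left mult_scaleC_right scaleC_scaleC algebra_simps 
        scaleR_2 complex_vector.scale_minus_left scaleC_one)
  with ha hb y show ?thesis using that by blast
qed

locale unital_cstar =
  fixes e :: "'a::cstar_algebra"
  assumes unit: "is_unit_element e" and unit_nonzero: "e \<noteq> 0"
begin

lemma mult_unit [simp]: "e * a = a" "a * e = a"
  using unit by (simp_all add: is_unit_element_def)

lemma adj_unit [simp]: "adj e = e"
  by (metis adj_adj adj_mult mult_unit(2))

lemma norm_unit [simp]: "norm e = 1"
  using cstar_identity[of e] unit_nonzero by (simp add: power2_eq_square)

text \<open>After scaling to \<open>norm (c\<^sup>2) \<le> 1\<close>, the element \<open>u = c + \<i> (1 - c\<^sup>2)\<^bsup>1/2\<^esup>\<close> is unitary and \<open>u\<^sup>2\<close> has real part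
  \<open>2 c\<^sup>2 - 1\<close>.\<close>

lemma norm_scaleR_unit_minus_square_le:
  assumes b: "adj b = b" and s: "norm (b * b) \<le> 2 * s"
  shows "norm (s *\<^sub>R e - b * b) \<le> s"
proof (cases "s = 0")
  case False
  then have s0: "s > 0" using s norm_ge_zero[of "b * b"] by linarith
  \<comment> \<open>With this scale \<open>b * b\<close> is \<open>2 * s\<close> times
    \<open>c * c\<close>, so that \<open>s e - b * b\<close> becomes \<open>- s\<close> times
    \<open>c * c - g * g\<close>, the real part of \<open>u * u\<close>.\<close>
  define r where "r = sqrt (2 * s)"
  have r: "r > 0" "r * r = 2 * s" using s0 by (simp_all add: r_def)
  define c where "c = (1/r) *\<^sub>R b"
  have c: "adj c = c" "b * b = (2 * s) *\<^sub>R (c * c)" using r s0 by (simp_all add: c_def b)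
  have "norm (c * c) \<le> 1" using s s0 unfolding c(2) by simp
  then obtain d where d: "adj d = d" "d * d = 2 *\<^sub>R d - c * c" 
    "\<And>x. x * (c * c) = (c * c) * x \<Longrightarrow> x * d = d * x"
    using sqrt_one_minus[of "c * c"] c(1) by (metis adj_mult)
  define g where "g = e - d"
  have g: "adj g = g" "g * g = e - c * c"
    using d(1,2) by (simp_all add: g_def algebra_simps scaleR_2)
  have cg: "c * g = g * c"
    using d(3)[of c] by (simp add: g_def algebra_simps)
  define u where "u = c + \<i> *\<^sub>C g"
  have adju: "adj u = c + (- \<i>) *\<^sub>C g" by (simp add: u_def c g adj_scaleC)
  have "adj u * u = c * c + g * g"
    unfolding adju unfolding u_def
    by (simp add: cg mult_scaleC_left mult_scaleC_right scaleC_scaleC algebra_simps 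
        complex_vector.scale_minus_left scaleC_one)
  then have "(norm u)\<^sup>2 = 1" using cstar_identity[of u] g(2) by simp
  then have u1: "norm u = 1" using power2_eq_1_iff[of "norm u"] norm_ge_zero[of u] by linarith
  have "u * u + adj u * adj u = 2 *\<^sub>R (c * c - g * g)"
    unfolding adju unfolding u_def
    by (simp add: cg mult_scaleC_left mult_scaleC_right scaleC_scaleC algebra_simps scaleR_2
        complex_vector.scale_minus_left scaleC_one)
  moreover have "norm (u * u + adj u * adj u) \<le> 2"
    using norm_triangle_ineq[of "u * u" "adj u * adj u"] norm_mult_ineq[of u u] 
      norm_mult_ineq[of "adj u" "adj u"] u1 by simp
  ultimately have "norm (c * c - g * g) \<le> 1" by simp
  moreover have "s *\<^sub>R e - b * b = (- s) *\<^sub>R (c * c - g * g)"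
    unfolding c(2) g(2) by (simp add: algebra_simps flip: scaleR_add_left)
  ultimately show ?thesis using s0 by (simp add: mult_left_le)
qed (use s in simp)

definition pos :: "'a \<Rightarrow> bool"
  where "pos a \<longleftrightarrow> adj a = a \<and> (\<exists>s\<ge>0. norm (s *\<^sub>R e - a) \<le> s)"

lemma pos_adj: "pos a \<Longrightarrow> adj a = a"
  by (simp add: pos_def)

lemma posI: "adj a = a \<Longrightarrow> norm (s *\<^sub>R e - a) \<le> s \<Longrightarrow> pos a"
  unfolding pos_def using norm_ge_zero order_trans by blast

lemma pos_add: "pos a \<Longrightarrow> pos b \<Longrightarrow> pos (a + b)"
proof -
  assume a: "pos a" and b: "pos b"
  obtain s where s: "s \<ge> 0" "norm (s *\<^sub>R e - a) \<le> s" using a unfolding pos_def by blast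
  obtain t where t: "t \<ge> 0" "norm (t *\<^sub>R e - b) \<le> t" using b unfolding pos_def by blast
  have "(s + t) *\<^sub>R e - (a + b) = (s *\<^sub>R e - a) + (t *\<^sub>R e - b)" by (simp add: algebra_simps)
  then have "norm ((s + t) *\<^sub>R e - (a + b)) \<le> s + t" 
    using s t norm_triangle_mono by metis
  then show ?thesis using posI pos_adj[OF a] pos_adj[OF b] by simp
qed

lemma pos_scaleR: "pos a \<Longrightarrow> r \<ge> 0 \<Longrightarrow> pos (r *\<^sub>R a)"
proof -
  assume a: "pos a" and r: "r \<ge> 0"
  obtain s where s: "s \<ge> 0" "norm (s *\<^sub>R e - a) \<le> s" using a unfolding pos_def by blast
  have "(r * s) *\<^sub>R e - r *\<^sub>R a = r *\<^sub>R (s *\<^sub>R e - a)" by (simp add: algebra_simps)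
  then have "norm ((r * s) *\<^sub>R e - r *\<^sub>R a) \<le> r * s" using s r by (simp add: mult_left_mono)
  then show ?thesis using posI pos_adj[OF a] by simp
qed

lemma pos_zero: "pos 0" by (rule posI[of _ 0]) simp_all

lemma pos_unit: "pos e" by (rule posI[of _ 1]) simp_all

lemma pos_norm_minus: "adj a = a \<Longrightarrow> norm a \<le> m \<Longrightarrow> pos (m *\<^sub>R e - a)"
  by (rule posI[of _ m]) simp_all

lemma pos_square: "adj b = b \<Longrightarrow> pos (b * b)"
  by (rule posI[OF _ norm_scaleR_unit_minus_square_le[of b "norm (b * b)"]]) simp_all

text \<open>Dividing by the radius gives \<open>a = s (e - d)\<close> with
  \<open>norm d \<le> 1\<close>, so the root is \<open>sqrt s (e - c)\<close> with \<open>c\<close>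
  from \<open>sqrt_one_minus\<close>. The bound \<open>norm c \<le> 1\<close> is what makes this
  root positive.\<close>

lemma pos_sqrt:
  assumes "pos a"
  obtains b where "pos b" "b * b = a" "\<And>c. c * a = a * c \<Longrightarrow> c * b = b * c"
proof -
  obtain s where s: "s \<ge> 0" "norm (s *\<^sub>R e - a) \<le> s" using assms unfolding pos_def by blast
  show ?thesis
  proof (cases "s = 0")
    case True
    then have "a = 0" using s by simp
    then show ?thesis using that[of 0] pos_zero by simp
  next
    case False
    then have s0: "s > 0" using s by simp
    define d where "d = e - (1/s) *\<^sub>R a"
    have a: "a = s *\<^sub>R (e - d)" using s0 by (simp add: d_def)
    have "s *\<^sub>R e - a = s *\<^sub>R d" unfolding a by (simp add: algebra_simps)
    then have "norm d \<le> 1" using s s0 by simp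
    moreover have "adj d = d" by (simp add: d_def pos_adj[OF assms])
    ultimately obtain c where c: "adj c = c" "norm c \<le> 1" "c * c = 2 *\<^sub>R c - d"
      "\<And>x. x * d = d * x \<Longrightarrow> x * c = c * x"
      using sqrt_one_minus[of d] by metis
    define b where "b = sqrt s *\<^sub>R (e - c)"
    have "sqrt s *\<^sub>R e - b = sqrt s *\<^sub>R c" by (simp add: b_def algebra_simps)
    then have "norm (sqrt s *\<^sub>R e - b) \<le> sqrt s" using c(2) s0 by (simp add: mult_left_le)
    then have "pos b" using posI c(1) by (simp add: b_def)
    moreover have "b * b = a"
      using s0 unfolding a b_def by (simp add: algebra_simps c(3) scaleR_2)
    moreover have "x * b = b * x" if "x * a = a * x" for x
      using c(4)[of x] that by (simp add: b_def d_def algebra_simps)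
    ultimately show ?thesis using that by blast
  qed
qed

text \<open>The definition of \<open>pos\<close> provides one particular radius; passing through the
  square root shows that every radius of at least half the norm serves.\<close>

lemma pos_norm_le:
  assumes "pos a" "norm a \<le> 2 * s"
  shows "norm (s *\<^sub>R e - a) \<le> s"
proof -
  obtain b where "pos b" "b * b = a" using pos_sqrt[OF assms(1)] by metis
  then show ?thesis using norm_scaleR_unit_minus_square_le[of b s] assms(2) pos_adj by simp
qed

text \<open>The product is the square of \<open>c * d\<close> for the roots \<open>c\<close> of
  \<open>a\<close> and \<open>d\<close> of \<open>b\<close>. Commutation is transferred twice: from
  \<open>a\<close> to \<open>c\<close>, then from \<open>b\<close> to \<open>d\<close>, which makes
  \<open>c * d\<close> hermitian.\<close>

lemma pos_mult:
  assumes a: "pos a" and b: "pos b" and ab: "a * b = b * a"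
  shows "pos (a * b)"
proof -
  obtain c where c: "pos c" "c * c = a" "\<And>x. x * a = a * x \<Longrightarrow> x * c = c * x"
    using pos_sqrt[OF a] by metis
  have bc: "b * c = c * b" using c(3) ab by simp
  obtain d where d: "pos d" "d * d = b" "\<And>x. x * b = b * x \<Longrightarrow> x * d = d * x"
    using pos_sqrt[OF b] by metis
  have cd: "c * d = d * c" using d(3) bc by simp
  have "(c * d) * (c * d) = a * b" unfolding c(2)[symmetric] d(2)[symmetric] using cd by (metis mult.assoc)
  moreover have "adj (c * d) = c * d" using cd c(1) d(1) by (simp add: pos_adj)
  ultimately show ?thesis using pos_square by metis
qed

text \<open>If \<open>a\<^sup>2 \<le> m\<^sup>2\<close> but \<open>K = norm (a\<^sup>2)\<close> exceeds \<open>m\<^sup>2\<close>, any \<open>\<nu>\<close> in \<open>[max m\<^sup>2 (K/2), K)\<close> bounds both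
  \<open>a\<^sup>2\<close> and \<open>\<nu> - a\<^sup>2\<close>, so that \<open>norm (a\<^sup>2) \<le> \<nu>\<close> by \<open>pos_norm_le\<close>: this replaces the spectral radius
  formula.\<close>

lemma norm_le_if_pos:
  assumes m: "m \<ge> 0" and p: "pos (m *\<^sub>R e - a)" "pos (m *\<^sub>R e + a)"
  shows "norm a \<le> m"
proof (rule ccontr)
  assume "\<not> norm a \<le> m"
  then have am: "m < norm a" by simp
  have "adj (m *\<^sub>R e + a) = m *\<^sub>R e + a" using p(2) pos_adj by blast
  then have ha: "adj a = a" by simp
  define X where "X = a * a"
  define K where "K = norm X"
  have K: "K = (norm a)\<^sup>2" unfolding K_def X_def by (rule norm_square_hermitian[OF ha])
  have mK: "m\<^sup>2 < K" unfolding K using am m by (simp add: power_strict_mono)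
  have K0: "0 < K" using mK zero_le_power2[of m] by linarith
  define \<nu> where "\<nu> = max (m\<^sup>2) (K/2)"
  have \<nu>: "m\<^sup>2 \<le> \<nu>" "K/2 \<le> \<nu>" "\<nu> < K" using mK K0 by (auto simp: \<nu>_def)
  have posX: "pos X" unfolding X_def by (rule pos_square[OF ha])
  have "pos ((m *\<^sub>R e - a) * (m *\<^sub>R e + a))"
    by (rule pos_mult[OF p]) (simp add: algebra_simps)
  moreover have "(m *\<^sub>R e - a) * (m *\<^sub>R e + a) = (m\<^sup>2) *\<^sub>R e - X"
    by (simp add: X_def algebra_simps power2_eq_square)
  ultimately have "pos (((m\<^sup>2) *\<^sub>R e - X) + (\<nu> - m\<^sup>2) *\<^sub>R e)"
    using \<nu>(1) by (intro pos_add pos_scaleR pos_unit) simp_all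
  then have pY: "pos (\<nu> *\<^sub>R e - X)" by (simp add: algebra_simps)
  \<comment> \<open>The radius \<open>K/2\<close> serves for \<open>X\<close>. Since
    \<open>\<nu>\<close> is at least \<open>K/2\<close>, enlarging it gives
    \<open>norm (\<nu> e - X) \<le> \<nu>\<close>, the size needed to apply
    \<open>pos_norm_le\<close> to \<open>\<nu> e - X\<close> at radius
    \<open>\<nu>/2\<close>.\<close>
  have "norm ((K/2) *\<^sub>R e - X) \<le> K/2" using pos_norm_le[OF posX, of "K/2"] by (simp add: K_def)
  moreover have "\<nu> *\<^sub>R e - X = (\<nu> - K/2) *\<^sub>R e + ((K/2) *\<^sub>R e - X)" by (simp add: algebra_simps)
  ultimately have "norm (\<nu> *\<^sub>R e - X) \<le> norm ((\<nu> - K/2) *\<^sub>R e) + K/2"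
    by (metis norm_triangle_mono order_refl)
  then have "norm (\<nu> *\<^sub>R e - X) \<le> \<nu>" using \<nu>(2) by simp
  then have "norm ((\<nu>/2) *\<^sub>R e - (\<nu> *\<^sub>R e - X)) \<le> \<nu>/2"
    using pos_norm_le[OF pY, of "\<nu>/2"] by simp
  then have "norm ((\<nu>/2) *\<^sub>R e + ((\<nu>/2) *\<^sub>R e - (\<nu> *\<^sub>R e - X))) \<le> norm ((\<nu>/2) *\<^sub>R e) + \<nu>/2"
    by (rule norm_triangle_mono[OF order_refl])
  moreover have "(\<nu>/2) *\<^sub>R e + ((\<nu>/2) *\<^sub>R e - (\<nu> *\<^sub>R e - X)) = X"
    by (simp add: algebra_simps flip: scaleR_add_left)
  ultimately have "K \<le> \<nu>" using \<nu>(2) K0 by (simp add: K_def)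
  then show False using \<nu>(3) by simp
qed

lemma pos_norm_le_unit:
  assumes "m \<ge> 0" "pos a" "pos (m *\<^sub>R e - a)"
  shows "norm a \<le> m"
  using assms by (intro norm_le_if_pos pos_add pos_scaleR pos_unit)

lemma pos_minus_norm_mono:
  assumes "pos a" "pos (b - a)"
  shows "norm a \<le> norm b"
proof (rule pos_norm_le_unit)
  have hb: "adj b = b" using pos_adj[OF assms(1)] pos_adj[OF assms(2)] by simp
  have "pos ((norm b *\<^sub>R e - b) + (b - a))"
    by (intro pos_add pos_norm_minus assms hb) simp
  then show "pos (norm b *\<^sub>R e - a)" by simp
qed (use assms in simp_all)

text \<open>As \<open>w\<close> intertwines \<open>u'\<close> with \<open>- u\<close> for \<open>u = w w\<^sup>*\<close>, the elements \<open>u' (m + u')\<^sup>2\<close> and \<open>u (m - u)\<^sup>2\<close>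
  have the same norm, which is at least \<open>m\<^sup>3\<close> and at most \<open>m\<^sup>3/4\<close> for \<open>m = norm u\<close>.\<close>

lemma zero_if_adj_mult_nonpos:
  assumes u': "pos u'" "adj w * w = - u'"
  shows "w = 0"
proof -
  define u where "u = w * adj w"
  define m where "m = norm u"
  have m: "m = (norm w)\<^sup>2" by (simp add: m_def u_def cstar_identity')
  have m': "m = norm u'" using cstar_identity[of w] u'(2) m by simp
  have m0: "m \<ge> 0" by (simp add: m_def)
  obtain a b where ab: "adj a = a" "adj b = b" "adj w * w + w * adj w = 2 *\<^sub>R (a * a + b * b)"
    using cartesian_decomposition[of w] by metis
  have "u = 2 *\<^sub>R (a * a + b * b) + u'" using ab(3) u'(2) by (simp add: u_def algebra_simps)
  then have pu: "pos u"
    using ab(1,2) u'(1) by (simp add: pos_add pos_scaleR pos_square)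
  define Q where "Q = m *\<^sub>R e + u'"
  define R where "R = m *\<^sub>R e - u"
  have "w * u' = - (u * w)"
    using arg_cong[OF u'(2), of "\<lambda>v. w * v"] by (simp add: u_def mult.assoc)
  then have wQ: "w * Q = R * w" by (simp add: Q_def R_def algebra_simps)
  have adjQ: "adj Q = Q" "adj R = R" by (simp_all add: Q_def R_def pos_adj u' pu)
  have "adj (w * Q) * (w * Q) = - (Q * u' * Q)"
    using arg_cong[OF u'(2), of "\<lambda>v. Q * v * Q"] by (simp add: adjQ mult.assoc)
  then have 1: "norm (Q * u' * Q) = (norm (w * Q))\<^sup>2" using cstar_identity[of "w * Q"] by simp
  have "(w * Q) * adj (w * Q) = R * u * R"
    unfolding wQ by (simp add: adjQ u_def mult.assoc)
  then have 2: "norm (R * u * R) = (norm (w * Q))\<^sup>2" using cstar_identity'[of "w * Q"] by simp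
  have "m ^ 3 \<le> norm (u' * u' * u')"
  proof (cases "m = 0")
    case False
    \<comment> \<open>Repeated squaring yields the norms of the second and fourth powers only, so
      the cube is bounded below through the fourth power.\<close>
    have "norm ((u' * u') * (u' * u')) = (m\<^sup>2)\<^sup>2"
      using norm_square_hermitian[of "u' * u'"] norm_square_hermitian[of u'] u'(1) m' pos_adj by simp
    moreover have "norm ((u' * u' * u') * u') \<le> norm (u' * u' * u') * m"
      unfolding m' by (rule norm_mult_ineq)
    ultimately have "m ^ 3 * m \<le> norm (u' * u' * u') * m" 
      by (simp add: mult.assoc power2_eq_square power3_eq_cube)
    then show ?thesis using False m0 by simp
  qed simp
  also have "\<dots> \<le> norm (Q * u' * Q)"
  proof (rule pos_minus_norm_mono)
    have sq: "pos (u' * u')" using pos_square pos_adj u'(1) by simp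
    then show "pos (u' * u' * u')" using pos_mult[OF _ u'(1)] by (simp add: mult.assoc)
    have "Q * u' * Q - u' * u' * u' = (2 * m) *\<^sub>R (u' * u') + (m * m) *\<^sub>R u'"
      by (simp add: Q_def algebra_simps scaleR_2 flip: scaleR_scaleR)
    then show "pos (Q * u' * Q - u' * u' * u')"
      using sq u'(1) m0 by (simp add: pos_add pos_scaleR)
  qed
  also have "\<dots> = norm ((R * u) * R)" using 1 2 by simp
  also have "\<dots> \<le> norm (R * u) * norm R" by (rule norm_mult_ineq)
  also have "\<dots> \<le> (m\<^sup>2 / 4) * m"
  proof (rule mult_mono)
    show R: "norm R \<le> m" unfolding R_def by (rule pos_norm_le[OF pu]) (use m0 in \<open>simp add: m_def\<close>)
    \<comment> \<open>The constant is the maximum of \<open>t * (m - t)\<close>, attained at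
      \<open>t = m / 2\<close>; the defect is the square of \<open>u - m / 2\<close>.\<close>
    show "norm (R * u) \<le> m\<^sup>2 / 4"
    proof (rule pos_norm_le_unit)
      have "pos R" unfolding R_def by (rule pos_norm_minus) (simp_all add: pu pos_adj m_def)
      then show "pos (R * u)" by (rule pos_mult[OF _ pu]) (simp add: R_def algebra_simps)
      have "(m\<^sup>2 / 4) *\<^sub>R e - R * u = (u - (m/2) *\<^sub>R e) * (u - (m/2) *\<^sub>R e)"
        by (simp add: R_def algebra_simps power2_eq_square flip: scaleR_add_left)
      then show "pos ((m\<^sup>2 / 4) *\<^sub>R e - R * u)" 
        using pos_square[of "u - (m/2) *\<^sub>R e"] pos_adj[OF pu] by simp
    qed simp
  qed simp_all
  finally have "m ^ 3 \<le> 0" by (simp add: power2_eq_square power3_eq_cube)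
  then have "m = 0" using m0 by (simp add: power_le_zero_eq)
  then show ?thesis using m by simp
qed

text \<open>Here \<open>r\<close> is the absolute value of \<open>T\<close>, and \<open>T\<close>
  acts as \<open>- r\<close> on the range of \<open>n\<close>. Hence \<open>w = y * n\<close> has a
  nonpositive \<open>adj w * w\<close> and vanishes; this forces \<open>n = 0\<close>, so that
  \<open>T = r\<close>.\<close>

lemma pos_adj_mult_self: "pos (adj y * y)"
proof -
  define T where "T = adj y * y"
  have hT: "adj T = T" by (simp add: T_def)
  obtain r where r: "pos r" "r * r = T * T" "\<And>c. c * (T * T) = (T * T) * c \<Longrightarrow> c * r = r * c"
    using pos_sqrt[OF pos_square[OF hT]] by metis
  have Tr: "T * r = r * T" by (rule r(3)) (simp add: mult.assoc)
  define n where "n = r - T" \<comment> \<open>twice the negative part of \<open>T\<close>\<close>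
  \<comment> \<open>The root of \<open>r\<close> turns \<open>n * r * n\<close> into the square of
    the hermitian element \<open>s * n\<close>.\<close>
  obtain s where s: "pos s" "s * s = r" "\<And>c. c * r = r * c \<Longrightarrow> c * s = s * c"
    using pos_sqrt[OF r(1)] by metis
  have ns: "n * s = s * n" by (rule s(3)) (simp add: n_def algebra_simps Tr)
  have hn: "adj n = n" by (simp add: n_def hT pos_adj r(1))
  have Tn: "T * n = - (r * n)" by (simp add: n_def algebra_simps Tr r(2))
  define w where "w = y * n"
  have "adj w * w = n * (T * n)" by (simp add: w_def hn T_def mult.assoc)
  also have "\<dots> = - ((s * n) * (s * n))"
    unfolding Tn s(2)[symmetric] by (simp add: ns flip: mult.assoc)
  finally have "w = 0"
    by (rule zero_if_adj_mult_nonpos[rotated]) (intro pos_square, simp add: hn pos_adj s(1) ns)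
  then have "T * n = 0" unfolding T_def w_def by (simp add: mult.assoc)
  moreover from this have "r * n = 0" using Tn by simp
  ultimately have "n * n = 0" by (simp add: n_def left_diff_distrib)
  then have "n = 0" using norm_square_hermitian[OF hn] by simp
  then show ?thesis using r(1) by (simp add: n_def T_def)
qed

text \<open>First-order tangency: \<open>x\<close> is a critical point of the norm in the direction \<open>b - x x\<^sup>* b\<close>.\<close>

lemma norm_perturbation_le_unital:
  fixes x b :: 'a
  assumes x: "norm x \<le> 1"
  shows "(norm (x + (b - x * adj x * b)))\<^sup>2 \<le> 1 + 2 * (norm b)\<^sup>2"
proof -
  define h k c z where "h = x * adj x" and "k = adj x * x" and "c = adj x * b" 
    and "z = x + (b - x * adj x * b)"
  have x2: "(norm x)\<^sup>2 \<le> 1" using x by (simp add: power_le_one)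
  have nh: "norm h \<le> 1" "norm k \<le> 1" using x2 by (simp_all add: h_def k_def cstar_identity cstar_identity')
  have adj: "adj h = h" "adj k = k" by (simp_all add: h_def k_def)
  have ph: "pos h" "pos k" using pos_adj_mult_self[of "adj x"] pos_adj_mult_self[of x] 
    by (simp_all add: h_def k_def)
  have n1: "norm (e - h) \<le> 1" "norm (e - k) \<le> 1" 
    using pos_norm_le[OF ph(1), of 1] pos_norm_le[OF ph(2), of 1] nh by simp_all
  have "pos (e - k)" using pos_norm_minus[of k 1] nh adj by simp
  then obtain r where r: "pos r" "r * r = e - k" using pos_sqrt by metis
  \<comment> \<open>Completing the square: since \<open>adj x * (e - h) = (e - k) * adj x\<close>,
    the part of \<open>adj z * z\<close> linear in \<open>b\<close> is
    \<open>(e - k) * c + adj c * (e - k)\<close>. Adding \<open>adj y * y\<close> cancels it and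
    leaves \<open>e\<close> plus the quadratic term \<open>G\<close>.\<close>
  define y where "y = r * (e - c)"
  have "adj y * y = (e - adj c) * (r * r) * (e - c)" by (simp add: y_def pos_adj r(1) mult.assoc)
  then have y: "adj y * y = (e - adj c) * (e - k) * (e - c)" using r(2) by simp
  define G where "G = adj c * (e - k) * c + adj b * (e - h) * ((e - h) * b)"
  have "adj z * z + adj y * y = e + G"
    unfolding y G_def z_def c_def h_def k_def by (simp add: algebra_simps)
  then have zy: "e + G - adj z * z = adj y * y" by (simp add: algebra_simps)
  have hG: "adj G = G" by (simp add: G_def adj mult.assoc)
  have "pos ((norm G *\<^sub>R e - G) + adj y * y)"
    by (intro pos_add pos_adj_mult_self pos_norm_minus hG) simp
  then have "pos ((1 + norm G) *\<^sub>R e - adj z * z)" unfolding zy[symmetric] by (simp add: algebra_simps)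
  then have "norm (adj z * z) \<le> 1 + norm G" by (intro pos_norm_le_unit pos_adj_mult_self) simp_all
  moreover have "norm G \<le> (norm b)\<^sup>2 + (norm b)\<^sup>2"
    unfolding G_def
  proof (rule norm_triangle_mono)
    have "norm c \<le> norm (adj x) * norm b" unfolding c_def by (rule norm_mult_ineq)
    also have "\<dots> \<le> norm b" using x by (simp add: mult_left_le_one_le)
    finally have nc: "norm c \<le> norm b" .
    have "norm (adj c * (e - k) * c) \<le> norm (adj c) * norm (e - k) * norm c"
      by (meson norm_mult_ineq order_trans mult_right_mono norm_ge_zero)
    also have "\<dots> \<le> norm b * 1 * norm b" using nc n1 by (intro mult_mono) simp_all
    finally show "norm (adj c * (e - k) * c) \<le> (norm b)\<^sup>2" by (simp add: power2_eq_square)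
    have "norm (adj b * (e - h) * ((e - h) * b)) \<le> (norm (adj b) * norm (e - h)) * (norm (e - h) * norm b)"
      by (meson norm_mult_ineq order_trans mult_mono norm_ge_zero)
    also have "\<dots> \<le> (norm b * 1) * (1 * norm b)" using n1 by (intro mult_mono) simp_all
    finally show "norm (adj b * (e - h) * ((e - h) * b)) \<le> (norm b)\<^sup>2" by (simp add: power2_eq_square)
  qed
  ultimately show ?thesis unfolding z_def[symmetric] by (simp add: cstar_identity)
qed

end

section \<open>The unitization\<close>

datatype 'a unitization = Unitization (base: 'a) (scalar: complex)

lemma unitization_eq_iff: "u = v \<longleftrightarrow> base u = base v \<and> scalar u = scalar v"
  by (metis unitization.expand)

instantiation unitization :: (cstar_algebra) complex_vector
begin

definition "0 = Unitization 0 0"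
definition "u + v = Unitization (base u + base v) (scalar u + scalar v)"
definition "u - v = Unitization (base u - base v) (scalar u - scalar v)"
definition "- u = Unitization (- base u) (- scalar u)"
definition "r *\<^sub>R u = Unitization (r *\<^sub>R base u) (r *\<^sub>R scalar u)"
definition "c *\<^sub>C u = Unitization (c *\<^sub>C base u) (c * scalar u)"

lemmas unitization_vector_defs = zero_unitization_def plus_unitization_def minus_unitization_def
  uminus_unitization_def scaleR_unitization_def scaleC_unitization_def

instance
  by standard
    (simp_all add: unitization_vector_defs unitization_eq_iff algebra_simps scaleC_add_right 
      scaleC_add_left scaleC_scaleC scaleC_one scaleR_scaleC scaleC_complex_def)

end

lemma unitization_vector_simps [simp]:
  "base 0 = 0" "scalar 0 = 0"
  "base (u + v) = base u + base v" "scalar (u + v) = scalar u + scalar v"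
  "base (u - v) = base u - base v" "scalar (u - v) = scalar u - scalar v"
  "base (- u) = - base u" "scalar (- u) = - scalar u"
  "base (r *\<^sub>R u) = r *\<^sub>R base u" "scalar (r *\<^sub>R u) = r *\<^sub>R scalar u"
  "base (c *\<^sub>C u) = c *\<^sub>C base u" "scalar (c *\<^sub>C u) = c * scalar u"
  by (simp_all add: unitization_vector_defs)

text \<open>Left multiplication on the original algebra. Its operator norm inherits the C*-identity,
  which the sum of the norms of the two components would not satisfy.\<close>

definition unitization_act :: "'a::cstar_algebra unitization \<Rightarrow> 'a \<Rightarrow> 'a"
  where "unitization_act u b = base u * b + scalar u *\<^sub>C b"

lemma bounded_linear_unitization_act: "bounded_linear (unitization_act u)"
  unfolding unitization_act_def
  by (intro bounded_linear_add bounded_linear_mult_right bounded_linear_scaleC)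

lemma unitization_act_add: "unitization_act (u + v) b = unitization_act u b + unitization_act v b"
  by (simp add: unitization_act_def distrib_right scaleC_add_left)

lemma unitization_act_scaleC: "unitization_act (c *\<^sub>C u) b = c *\<^sub>C unitization_act u b"
  by (simp add: unitization_act_def scaleC_add_right mult_scaleC_left scaleC_scaleC)

instantiation unitization :: (cstar_algebra) complex_normed_vector
begin

text \<open>The maximum with \<open>cmod (scalar u)\<close> keeps this definite if \<open>'a\<close> already has a unit.\<close>

definition norm_unitization :: "'a unitization \<Rightarrow> real"
  where "norm_unitization u = max (cmod (scalar u)) (onorm (unitization_act u))"

definition sgn_unitization :: "'a unitization \<Rightarrow> 'a unitization"
  where "sgn_unitization u = u /\<^sub>R norm u"

definition dist_unitization :: "'a unitization \<Rightarrow> 'a unitization \<Rightarrow> real"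
  where "dist_unitization u v = norm (u - v)"

definition uniformity_unitization :: "('a unitization \<times> 'a unitization) filter"
  where "uniformity_unitization = (INF \<epsilon>\<in>{0<..}. principal {(u, v). dist u v < \<epsilon>})"

definition open_unitization :: "'a unitization set \<Rightarrow> bool"
  where "open_unitization U \<longleftrightarrow> (\<forall>u\<in>U. eventually (\<lambda>(u', v). u' = u \<longrightarrow> v \<in> U) uniformity)"

lemma norm_unitization_act_le: "norm (unitization_act u b) \<le> norm u * norm b"
proof -
  have "norm (unitization_act u b) \<le> onorm (unitization_act u) * norm b"
    by (rule onorm[OF bounded_linear_unitization_act])
  also have "\<dots> \<le> norm u * norm b" by (intro mult_right_mono) (simp_all add: norm_unitization_def)
  finally show ?thesis .
qed

lemma cmod_scalar_le: "cmod (scalar u) \<le> norm u"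
  by (simp add: norm_unitization_def)

lemma norm_unitization_leI:
  assumes "cmod (scalar u) \<le> K" "\<And>b. norm (unitization_act u b) \<le> K * norm b"
  shows "norm u \<le> K"
  unfolding norm_unitization_def
  using assms onorm_bound[of K "unitization_act u"] norm_ge_zero order_trans by (metis max.boundedI)

text \<open>Testing the action on \<open>adj (base u)\<close> recovers \<open>base u\<close> by the
  C*-identity; the second half of the factor 2 pays for the scalar. This gives definiteness of the
  norm and, later, completeness.\<close>

lemma norm_base_le: "norm (base u) \<le> 2 * norm u"
proof (cases "base u = 0")
  case True
  then show ?thesis using order_trans[OF norm_ge_zero cmod_scalar_le, of u] by simp
next
  case False
  have "base u * adj (base u) = unitization_act u (adj (base u)) - scalar u *\<^sub>C adj (base u)"
    by (simp add: unitization_act_def)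
  then have "(norm (base u))\<^sup>2 \<le> norm (unitization_act u (adj (base u))) + norm (scalar u *\<^sub>C adj (base u))"
    unfolding cstar_identity'[symmetric] by (simp add: norm_triangle_ineq4)
  also have "\<dots> \<le> norm u * norm (base u) + norm u * norm (base u)"
    using norm_unitization_act_le[of u "adj (base u)"] mult_right_mono[OF cmod_scalar_le[of u], of "norm (base u)"] 
    by (simp add: norm_scaleC)
  finally show ?thesis using False by (simp add: power2_eq_square)
qed

lemma norm_unitization_scaleC_le: "norm (c *\<^sub>C u) \<le> cmod c * norm (u::'a unitization)"
  by (rule norm_unitization_leI)
     (simp_all add: norm_mult cmod_scalar_le mult_left_mono unitization_act_scaleC norm_scaleC 
       norm_unitization_act_le mult.assoc)

instance
proof
  fix u v :: "'a unitization" and r :: real and c :: complex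
  show C: "norm (c *\<^sub>C u) = cmod c * norm u" for c and u :: "'a unitization"
  proof (rule antisym[OF norm_unitization_scaleC_le])
    show "cmod c * norm u \<le> norm (c *\<^sub>C u)"
    proof (cases "c = 0")
      case True
      then show ?thesis using order_trans[OF norm_ge_zero cmod_scalar_le, of "c *\<^sub>C u"] by simp
    next
      case False
      then have "norm u \<le> cmod (inverse c) * norm (c *\<^sub>C u)"
        using norm_unitization_scaleC_le[of "inverse c" "c *\<^sub>C u"] by (simp add: scaleC_scaleC scaleC_one)
      then show ?thesis using mult_left_mono[of _ _ "cmod c"] False by (fastforce simp: norm_inverse simp flip: mult.assoc)
    qed
  qed
  show "norm (r *\<^sub>R u) = \<bar>r\<bar> * norm u" using C[of "complex_of_real r" u] by (simp add: scaleR_scaleC)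
  show "norm (u + v) \<le> norm u + norm v"
  proof (rule norm_unitization_leI)
    show "cmod (scalar (u + v)) \<le> norm u + norm v"
      using norm_triangle_mono[OF cmod_scalar_le cmod_scalar_le] by simp
    show "norm (unitization_act (u + v) b) \<le> (norm u + norm v) * norm b" for b
      using norm_triangle_mono[OF norm_unitization_act_le norm_unitization_act_le] 
      by (simp add: unitization_act_add distrib_right)
  qed
  show "norm u = 0 \<longleftrightarrow> u = 0"
  proof
    assume "norm u = 0"
    then show "u = 0" using norm_base_le[of u] cmod_scalar_le[of u] by (simp add: unitization_eq_iff)
  next
    assume "u = 0"
    then show "norm u = 0" using C[of 0 u] by simp
  qed
qed (simp_all add: sgn_unitization_def dist_unitization_def uniformity_unitization_def 
      open_unitization_def)

end

instantiation unitization :: (cstar_algebra) cstar_algebra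
begin

definition times_unitization :: "'a unitization \<Rightarrow> 'a unitization \<Rightarrow> 'a unitization"
  where "u * v = Unitization (base u * base v + scalar u *\<^sub>C base v + scalar v *\<^sub>C base u)
    (scalar u * scalar v)"

definition adj_unitization :: "'a unitization \<Rightarrow> 'a unitization"
  where "adj u = Unitization (adj (base u)) (cnj (scalar u))"

lemma unitization_algebra_simps [simp]:
  "base (u * v) = base u * base v + scalar u *\<^sub>C base v + scalar v *\<^sub>C base u"
  "scalar (u * v) = scalar u * scalar v"
  "base (adj u) = adj (base u)" "scalar (adj u) = cnj (scalar u)"
  by (simp_all add: times_unitization_def adj_unitization_def)

lemma unitization_act_mult: "unitization_act (u * v) b = unitization_act u (unitization_act v b)"
  by (simp add: unitization_act_def algebra_simps mult_scaleC_left mult_scaleC_right 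
      scaleC_scaleC scaleC_add_right)

lemma norm_unitization_mult: "norm (u * v) \<le> norm u * norm (v :: 'a unitization)"
proof (rule norm_unitization_leI)
  show "cmod (scalar (u * v)) \<le> norm u * norm v"
    using mult_mono[OF cmod_scalar_le cmod_scalar_le] by (simp add: norm_mult)
  fix b
  have "norm (unitization_act (u * v) b) \<le> norm u * norm (unitization_act v b)"
    unfolding unitization_act_mult by (rule norm_unitization_act_le)
  also have "\<dots> \<le> norm u * (norm v * norm b)" by (intro mult_left_mono norm_unitization_act_le) simp
  finally show "norm (unitization_act (u * v) b) \<le> norm u * norm v * norm b" by (simp add: mult.assoc)
qed

text \<open>The C*-identity of the original algebra, applied to \<open>unitization_act u b\<close>,
  moves \<open>adj u\<close> across the product and leaves \<open>adj u * u\<close> acting on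
  \<open>b\<close>.\<close>

lemma norm_unitization_square_le: "(norm u)\<^sup>2 \<le> norm (adj u * (u :: 'a unitization))"
proof -
  define N where "N = norm (adj u * u)"
  have "norm u \<le> sqrt N"
  proof (rule norm_unitization_leI)
    have "(cmod (scalar u))\<^sup>2 \<le> N"
      using cmod_scalar_le[of "adj u * u"] by (simp add: N_def norm_mult power2_eq_square)
    then show "cmod (scalar u) \<le> sqrt N" by (rule real_le_rsqrt)
    fix b
    have "adj (unitization_act u b) * unitization_act u b = adj b * unitization_act (adj u * u) b"
      by (simp add: unitization_act_def algebra_simps mult_scaleC_left mult_scaleC_right adj_scaleC
          scaleC_scaleC scaleC_add_right)
    then have "(norm (unitization_act u b))\<^sup>2 \<le> norm (adj b) * norm (unitization_act (adj u * u) b)"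
      using norm_mult_ineq cstar_identity by metis
    also have "\<dots> \<le> norm b * (N * norm b)"
      unfolding N_def norm_adj by (intro mult_left_mono norm_unitization_act_le) simp
    finally have "norm (unitization_act u b) \<le> sqrt (N * (norm b)\<^sup>2)"
      by (intro real_le_rsqrt) (simp add: power2_eq_square mult_ac)
    then show "norm (unitization_act u b) \<le> sqrt N * norm b" by (simp add: real_sqrt_mult)
  qed
  then show ?thesis using power_mono[of "norm u" "sqrt N" 2] by (simp add: N_def)
qed

instance
proof
  fix u v w :: "'a unitization" and r :: real and c :: complex
  show "u * v * w = u * (v * w)"
    by (simp add: unitization_eq_iff algebra_simps mult_scaleC_left mult_scaleC_right 
        scaleC_scaleC scaleC_add_right)
  show "(u + v) * w = u * w + v * w" "u * (v + w) = u * v + u * w"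
    by (simp_all add: unitization_eq_iff algebra_simps scaleC_add_right scaleC_add_left)
  show "r *\<^sub>R u * v = r *\<^sub>R (u * v)" "u * r *\<^sub>R v = r *\<^sub>R (u * v)"
    by (simp_all add: unitization_eq_iff scaleR_scaleC mult_scaleC_left mult_scaleC_right 
        scaleC_scaleC scaleC_add_right scaleR_conv_of_real mult_ac)
  show "norm (u * v) \<le> norm u * norm v" by (rule norm_unitization_mult)
  show "c *\<^sub>C u * v = c *\<^sub>C (u * v)" "u * c *\<^sub>C v = c *\<^sub>C (u * v)"
    by (simp_all add: unitization_eq_iff mult_scaleC_left mult_scaleC_right 
        scaleC_scaleC scaleC_add_right mult_ac)
  show aa: "adj (adj u) = u" for u :: "'a unitization" by (simp add: unitization_eq_iff)
  show "adj (u + v) = adj u + adj v" "adj (c *\<^sub>C u) = cnj c *\<^sub>C adj u" "adj (u * v) = adj v * adj u"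
    by (simp_all add: unitization_eq_iff adj_scaleC algebra_simps)
  have le: "norm u \<le> norm (adj u)" for u :: "'a unitization"
  proof (cases "u = 0")
    case False
    have "norm u * norm u \<le> norm (adj u) * norm u"
      using norm_unitization_square_le[of u] norm_unitization_mult[of "adj u" u] by (simp add: power2_eq_square)
    then show ?thesis using False by simp
  qed simp
  have "norm (adj u) = norm u" using le[of u] le[of "adj u"] aa by simp
  then show "norm (adj u * u) = (norm u)\<^sup>2"
    using norm_unitization_square_le[of u] norm_unitization_mult[of "adj u" u] by (simp add: power2_eq_square)
  show "convergent X" if "Cauchy X" for X :: "nat \<Rightarrow> 'a unitization"
  proof -
    have "bounded_linear (base :: 'a unitization \<Rightarrow> 'a)"
      by (rule bounded_linear_intro[where K = 2]) (use norm_base_le in \<open>simp_all add: mult.commute\<close>)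
    then have b: "Cauchy (\<lambda>n. base (X n))" by (rule bounded_linear.Cauchy[OF _ that])
    have "bounded_linear (scalar :: 'a unitization \<Rightarrow> complex)"
      by (rule bounded_linear_intro[where K = 1]) (simp_all add: cmod_scalar_le)
    then have s: "Cauchy (\<lambda>n. scalar (X n))" by (rule bounded_linear.Cauchy[OF _ that])
    obtain a l where al: "(\<lambda>n. base (X n)) \<longlonglongrightarrow> a" "(\<lambda>n. scalar (X n)) \<longlonglongrightarrow> l"
      using b[THEN Cauchy_convergent] s[THEN Cauchy_convergent] unfolding convergent_def by blast
    \<comment> \<open>Together with the continuity of both components, this reverse bound makes
      convergence in the unitization componentwise.\<close>
    have bnd: "norm u \<le> norm (base u) + cmod (scalar u)" for u :: "'a unitization"
    proof (rule norm_unitization_leI)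
      show "norm (unitization_act u b) \<le> (norm (base u) + cmod (scalar u)) * norm b" for b
        unfolding unitization_act_def distrib_right
        by (rule norm_triangle_mono) (simp_all add: norm_mult_ineq norm_scaleC)
    qed simp
    have "(\<lambda>n. norm (base (X n) - a) + cmod (scalar (X n) - l)) \<longlonglongrightarrow> norm (a - a) + cmod (l - l)"
      by (intro tendsto_intros al)
    then have "(\<lambda>n. norm (base (X n) - a) + cmod (scalar (X n) - l)) \<longlonglongrightarrow> 0" by simp
    then have "(\<lambda>n. X n - Unitization a l) \<longlonglongrightarrow> 0"
      by (rule Lim_null_comparison[rotated]) (use bnd[of "X _ - Unitization a l"] in \<open>simp\<close>)
    then show ?thesis using LIM_zero_iff convergentI by blast
  qed
qed

end

interpretation unitization: unital_cstar "Unitization (0::'a::cstar_algebra) 1"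
  by unfold_locales (simp_all add: is_unit_element_def unitization_eq_iff scaleC_one)

lemma norm_embed: "norm (Unitization a 0) = norm (a::'a::cstar_algebra)"
proof (rule antisym)
  have act: "unitization_act (Unitization a 0) b = a * b" for b by (simp add: unitization_act_def)
  show "norm (Unitization a 0) \<le> norm a"
    by (rule norm_unitization_leI) (simp_all add: act norm_mult_ineq)
  have "norm a * norm a \<le> norm (Unitization a 0) * norm a"
    using norm_unitization_act_le[of "Unitization a 0" "adj a"] unfolding act
    by (simp add: cstar_identity' power2_eq_square)
  then show "norm a \<le> norm (Unitization a 0)" by (cases "a = 0") simp_all
qed

lemma norm_perturbation_le:
  fixes x b :: "'a::cstar_algebra"
  assumes "norm x \<le> 1"
  shows "(norm (x + (b - x * adj x * b)))\<^sup>2 \<le> 1 + 2 * (norm b)\<^sup>2"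
proof -
  have "Unitization x 0 + (Unitization b 0 - Unitization x 0 * adj (Unitization x 0) * Unitization b 0)
      = Unitization (x + (b - x * adj x * b)) 0"
    by (simp add: unitization_eq_iff)
  then show ?thesis
    using unitization.norm_perturbation_le_unital[of "Unitization x 0" "Unitization b 0"] assms
    by (simp add: norm_embed)
qed

section \<open>The Hahn--Banach theorem\<close>

definition sublinear :: "('v::real_vector \<Rightarrow> real) \<Rightarrow> bool"
  where "sublinear q \<longleftrightarrow> (\<forall>x y. q (x + y) \<le> q x + q y) \<and> (\<forall>r>0. \<forall>x. q (r *\<^sub>R x) \<le> r * q x)"

lemma sublinearD:
  assumes "sublinear q"
  shows "q (x + y) \<le> q x + q y" and "0 \<le> r \<Longrightarrow> q (r *\<^sub>R x) = r * q x" and "- q (- x) \<le> q x"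
proof -
  show add: "q (x + y) \<le> q x + q y" for x y using assms by (simp add: sublinear_def)
  have le: "q (r *\<^sub>R x) \<le> r * q x" if "r > 0" for r x using assms that by (simp add: sublinear_def)
  have z: "q 0 = 0" using le[of 2 0] le[of "1/2" 0] by simp
  show "q (r *\<^sub>R x) = r * q x" if r: "0 \<le> r"
  proof (cases "r = 0")
    case False
    then have "q x \<le> (1/r) * q (r *\<^sub>R x)" using le[of "1/r" "r *\<^sub>R x"] r by simp
    then have "r * q x \<le> q (r *\<^sub>R x)" using r False by (simp add: field_simps)
    then show ?thesis using le[of r x] r False by simp
  qed (simp add: z)
  show "- q (- x) \<le> q x" using add[of x "- x"] z by simp
qed

text \<open>A linear \<open>g\<close> below \<open>q'\<close> satisfies
  \<open>g (- c) \<le> - f c\<close>, that is, \<open>f c \<le> g c\<close> on \<open>C\<close>. So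
  a two-sided constraint on \<open>g\<close> becomes the single bound \<open>q'\<close>, the infimum
  of \<open>q (x + c) - f c\<close> over \<open>C\<close>.\<close>

lemma sublinear_inf_convolution:
  fixes q f :: "'v::real_vector \<Rightarrow> real"
  assumes q: "sublinear q"
    and C: "0 \<in> C" "\<And>c d. c \<in> C \<Longrightarrow> d \<in> C \<Longrightarrow> c + d \<in> C" "\<And>r c. r > 0 \<Longrightarrow> c \<in> C \<Longrightarrow> r *\<^sub>R c \<in> C"
    and f: "\<And>c d. c \<in> C \<Longrightarrow> d \<in> C \<Longrightarrow> f c + f d \<le> f (c + d)" 
      "\<And>r c. r > 0 \<Longrightarrow> c \<in> C \<Longrightarrow> f (r *\<^sub>R c) = r * f c" "\<And>c. c \<in> C \<Longrightarrow> f c \<le> q c"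
  obtains q' where "sublinear q'" "\<And>x. q' x \<le> q x" "\<And>c. c \<in> C \<Longrightarrow> q' (- c) \<le> - f c"
proof -
  define q' where "q' x = (INF c\<in>C. q (x + c) - f c)" for x
  \<comment> \<open>A lower bound independent of \<open>c\<close>; without it the infimum would be
    an arbitrary value.\<close>
  have lb: "- q (- x) \<le> q (x + c) - f c" if "c \<in> C" for x c
    using f(3)[OF that] sublinearD(1)[OF q, of "x + c" "- x"] by simp
  have le: "q' x \<le> q (x + c) - f c" if "c \<in> C" for x c
    unfolding q'_def by (rule cINF_lower) (use that lb in \<open>auto intro!: bdd_belowI2\<close>)
  have ge: "B \<le> q' x" if "\<And>c. c \<in> C \<Longrightarrow> B \<le> q (x + c) - f c" for B x
    unfolding q'_def by (rule cINF_greatest) (use that C(1) in auto)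
  have f0: "f 0 = 0" using f(2)[OF _ C(1), of 2] by simp
  have "sublinear q'"
    unfolding sublinear_def
  proof (intro conjI allI impI)
    fix x y
    have "q' (x + y) - (q (x + c) - f c) \<le> q' y" if c: "c \<in> C" for c
    proof (rule ge)
      fix d assume d: "d \<in> C"
      have "q' (x + y) \<le> q (x + y + (c + d)) - f (c + d)" by (rule le[OF C(2)[OF c d]])
      moreover have "q (x + y + (c + d)) \<le> q (x + c) + q (y + d)"
        using sublinearD(1)[OF q, of "x + c" "y + d"] by (simp add: algebra_simps)
      ultimately show "q' (x + y) - (q (x + c) - f c) \<le> q (y + d) - f d" using f(1)[OF c d] by linarith
    qed
    then have "q' (x + y) - q' y \<le> q' x" by (intro ge) (simp add: algebra_simps)
    then show "q' (x + y) \<le> q' x + q' y" by simp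
  next
    fix r :: real and x assume r: "0 < r"
    have "q' (r *\<^sub>R x) / r \<le> q' x"
    proof (rule ge)
      fix c assume c: "c \<in> C"
      have "q' (r *\<^sub>R x) \<le> q (r *\<^sub>R (x + c)) - f (r *\<^sub>R c)"
        using le[OF C(3)[OF r c], of "r *\<^sub>R x"] by (simp add: scaleR_add_right)
      also have "\<dots> = r * (q (x + c) - f c)"
        using sublinearD(2)[OF q, of r "x + c"] f(2)[OF r c] r by (simp add: right_diff_distrib)
      finally show "q' (r *\<^sub>R x) / r \<le> q (x + c) - f c" using r by (simp add: field_simps)
    qed
    then show "q' (r *\<^sub>R x) \<le> r * q' x" using r by (simp add: field_simps)
  qed
  moreover have "q' x \<le> q x" for x using le[OF C(1), of x] f0 by simp
  moreover have "q' (- c) \<le> - f c" if "c \<in> C" for c 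
    using le[OF that, of "- c"] sublinearD(2)[OF q, of 0 0] by simp
  ultimately show ?thesis using that by blast
qed

text \<open>Inf-convolution of \<open>q\<close> with itself along the ray through \<open>y\<close>
  cannot lower \<open>q\<close>, by minimality. This forces \<open>q (- y) \<le> - q y\<close>, and
  an odd sublinear function is linear.\<close>

lemma minimal_sublinear_linear:
  assumes q: "sublinear q" and min: "\<And>q'. sublinear q' \<Longrightarrow> (\<And>x. q' x \<le> q x) \<Longrightarrow> q' = q"
  shows "linear q"
proof -
  have neg: "q (- y) = - q y" for y
  proof -
    define C where "C = {t *\<^sub>R y |t. 0 \<le> t}"
    have C0: "0 \<in> C" unfolding C_def by force
    have C1: "c + d \<in> C" if "c \<in> C" "d \<in> C" for c d
      using that unfolding C_def by (force simp flip: scaleR_add_left)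
    have C2: "r *\<^sub>R c \<in> C" if "r > 0" "c \<in> C" for r c
      using that unfolding C_def by (force intro: mult_nonneg_nonneg less_imp_le)
    have f1: "q c + q d \<le> q (c + d)" if cd: "c \<in> C" "d \<in> C" for c d
    proof -
      obtain s t where "c = s *\<^sub>R y" "d = t *\<^sub>R y" "0 \<le> s" "0 \<le> t" using cd unfolding C_def by blast
      then show ?thesis
        using sublinearD(2)[OF q, of s y] sublinearD(2)[OF q, of t y] sublinearD(2)[OF q, of "s + t" y]
        by (simp add: scaleR_add_left distrib_right)
    qed
    obtain q' where q': "sublinear q'" "\<And>x. q' x \<le> q x" "\<And>c. c \<in> C \<Longrightarrow> q' (- c) \<le> - q c"
      using sublinear_inf_convolution[of q C q, OF q C0 C1 C2 f1 sublinearD(2)[OF q less_imp_le] order_refl]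
      by blast
    have "y \<in> C" unfolding C_def by (rule CollectI, rule exI[of _ 1]) simp
    then have "q (- y) \<le> - q y" using min[OF q'(1,2)] q'(3) by blast
    then show ?thesis using sublinearD(3)[OF q, of y] by linarith
  qed
  show ?thesis
  proof
    fix x y
    show "q (x + y) = q x + q y"
      using sublinearD(1)[OF q, of x y] sublinearD(1)[OF q, of "- x" "- y"] neg[of x] neg[of y] neg[of "x + y"]
      by simp
  next
    fix r x
    show "q (r *\<^sub>R x) = r *\<^sub>R q x"
    proof (cases "0 \<le> r")
      case False
      then have "q ((- r) *\<^sub>R x) = (- r) * q x" by (intro sublinearD(2)[OF q]) simp
      then show ?thesis using neg[of "r *\<^sub>R x"] by simp
    qed (simp add: sublinearD(2)[OF q])
  qed
qed

text \<open>Zorn's lemma is used downwards: a chain is bounded below by its pointwise infimum, kept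
  finite by \<open>- p (- x)\<close>. Minimal sublinear functions are linear, so no extension by one
  dimension at a time occurs.\<close>

lemma linear_below_sublinear:
  fixes p :: "'v::real_vector \<Rightarrow> real"
  assumes p: "sublinear p"
  obtains g where "linear g" "\<And>x. g x \<le> p x"
proof -
  define A where "A = {q. sublinear q \<and> q \<le> p}"
  have "\<exists>m\<in>A. \<forall>a\<in>A. a \<le> m \<longrightarrow> a = m"
  proof (rule predicate_Zorn[where P = "\<lambda>a b. b \<le> a", simplified])
    show "partial_order_on A (relation_of (\<lambda>a b. b \<le> a) A)"
      by (rule partial_order_on_relation_ofI) auto
    fix K assume K: "K \<in> Chains (relation_of (\<lambda>a b. b \<le> a) A)"
    show "\<exists>u\<in>A. \<forall>a\<in>K. u \<le> a"
    proof (cases "K = {}")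
      case True
      then show ?thesis using p by (auto simp: A_def)
    next
      case False
      have KA: "K \<subseteq> A" and tot: "\<And>a b. a \<in> K \<Longrightarrow> b \<in> K \<Longrightarrow> a \<le> b \<or> b \<le> a"
        using K by (auto simp: Chains_def relation_of_def)
      define u where "u x = (INF q\<in>K. q x)" for x
      have sub: "sublinear q" "\<And>x. q x \<le> p x" if "q \<in> K" for q
        using KA that by (auto simp: A_def le_fun_def)
      have lb: "- p (- x) \<le> q x" if "q \<in> K" for q x
        using sublinearD(3)[OF sub(1)[OF that], of x] sub(2)[OF that, of "- x"] by linarith
      have le: "u x \<le> q x" if "q \<in> K" for q x
        unfolding u_def by (rule cINF_lower) (use that lb in \<open>auto intro!: bdd_belowI2\<close>)
      have ge: "B \<le> u x" if "\<And>q. q \<in> K \<Longrightarrow> B \<le> q x" for B x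
        unfolding u_def by (rule cINF_greatest) (use that False in auto)
      have "sublinear u"
        unfolding sublinear_def
      proof (intro conjI allI impI)
        fix x y
        have "u (x + y) - a x \<le> u y" if a: "a \<in> K" for a
        proof (rule ge)
          fix b assume b: "b \<in> K"
          \<comment> \<open>One member of the chain must serve both arguments: the smaller of
            \<open>a\<close> and \<open>b\<close>.\<close>
          obtain c where c: "c \<in> K" "c \<le> a" "c \<le> b" using tot[OF a b] a b by blast
          show "u (x + y) - a x \<le> b y"
            using le[OF c(1), of "x + y"] sublinearD(1)[OF sub(1)[OF c(1)], of x y] 
              le_funD[OF c(2), of x] le_funD[OF c(3), of y] by linarith
        qed
        then have "u (x + y) - u y \<le> u x" by (intro ge) (simp add: algebra_simps)
        then show "u (x + y) \<le> u x + u y" by simp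
      next
        fix r :: real and x assume r: "0 < r"
        have "u (r *\<^sub>R x) / r \<le> u x"
        proof (rule ge)
          fix a assume a: "a \<in> K"
          show "u (r *\<^sub>R x) / r \<le> a x"
            using le[OF a, of "r *\<^sub>R x"] sublinearD(2)[OF sub(1)[OF a], of r x] r by (simp add: field_simps)
        qed
        then show "u (r *\<^sub>R x) \<le> r * u x" using r by (simp add: field_simps)
      qed
      moreover have "u \<le> p" using False le sub(2) order_trans by (metis ex_in_conv le_funI)
      ultimately show ?thesis using le by (auto simp: A_def le_fun_def)
    qed
  qed
  then obtain g where g: "g \<in> A" "\<And>a. a \<in> A \<Longrightarrow> a \<le> g \<Longrightarrow> a = g" by blast
  have "linear g"
  proof (rule minimal_sublinear_linear)
    show "sublinear g" using g(1) by (simp add: A_def)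
    show "q' = g" if "sublinear q'" "\<And>x. q' x \<le> g x" for q'
      using g that order_trans[of q' g p] by (simp add: A_def le_fun_def)
  qed
  then show ?thesis using that g(1) by (auto simp: A_def le_fun_def)
qed

text \<open>The cones used later are a ray, for separating points, and the positive cone of a unital
  algebra.\<close>

theorem hahn_banach_cone:
  fixes q f :: "'v::real_vector \<Rightarrow> real"
  assumes "sublinear q"
    and "0 \<in> C" "\<And>c d. c \<in> C \<Longrightarrow> d \<in> C \<Longrightarrow> c + d \<in> C" "\<And>r c. r > 0 \<Longrightarrow> c \<in> C \<Longrightarrow> r *\<^sub>R c \<in> C"
    and "\<And>c d. c \<in> C \<Longrightarrow> d \<in> C \<Longrightarrow> f c + f d \<le> f (c + d)" 
      "\<And>r c. r > 0 \<Longrightarrow> c \<in> C \<Longrightarrow> f (r *\<^sub>R c) = r * f c" "\<And>c. c \<in> C \<Longrightarrow> f c \<le> q c"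
  obtains g where "linear g" "\<And>x. g x \<le> q x" "\<And>c. c \<in> C \<Longrightarrow> f c \<le> g c"
proof -
  obtain q' where q': "sublinear q'" "\<And>x. q' x \<le> q x" "\<And>c. c \<in> C \<Longrightarrow> q' (- c) \<le> - f c"
    using sublinear_inf_convolution[of q C f] assms by blast
  obtain g where g: "linear g" "\<And>x. g x \<le> q' x" using linear_below_sublinear[OF q'(1)] by blast
  have "f c \<le> g c" if "c \<in> C" for c
    using g(2)[of "- c"] q'(3)[OF that] linear_neg[OF g(1)] by simp
  then show ?thesis using that g q'(2) order_trans by blast
qed

section \<open>Complex functionals from real-linear ones\<close>

lemma complex_dual_of_real:
  fixes g :: "'a::complex_normed_vector \<Rightarrow> real"
  assumes g: "linear g" and K: "0 \<le> K" and bound: "\<And>x. g x \<le> K * norm x"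
  obtains F where "F \<in> complex_dual" "\<And>x. Re (blinfun_apply F x) = g x" "norm F \<le> K"
proof -
  define F where "F x = Complex (g x) (- g (\<i> *\<^sub>C x))" for x
  have add: "F (x + y) = F x + F y" for x y
    by (simp add: F_def linear_add[OF g] scaleC_add_right complex_eq_iff)
  have hom: "F (c *\<^sub>C x) = c * F x" for c x
  proof -
    have gc: "g (c *\<^sub>C x) = Re c * g x + Im c * g (\<i> *\<^sub>C x)" for c x
    proof -
      have "c *\<^sub>C x = Re c *\<^sub>R x + Im c *\<^sub>R (\<i> *\<^sub>C x)"
        unfolding scaleR_scaleC scaleC_scaleC scaleC_add_left[symmetric]
        by (metis complex_eq mult.commute)
      then show ?thesis by (simp add: linear_add[OF g] linear_scale[OF g])
    qed
    have "g (\<i> *\<^sub>C c *\<^sub>C x) = - Im c * g x + Re c * g (\<i> *\<^sub>C x)"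
      unfolding scaleC_scaleC gc[of "\<i> * c"] by simp
    then show ?thesis by (simp add: F_def gc[of c] complex_eq_iff)
  qed
  have bnd: "cmod (F x) \<le> K * norm x" for x
  proof (cases "F x = 0")
    case True
    then have "g x = 0" by (simp add: F_def complex_eq_iff)
    then show ?thesis using bound[of x] True by simp
  next
    case False
    \<comment> \<open>This phase rotates \<open>x\<close> until the value of \<open>F\<close> is
      real and so equal to \<open>g\<close>; hence the one-sided bound on \<open>g\<close> yields
      the same constant for \<open>F\<close>.\<close>
    define c where "c = cnj (F x) / cmod (F x)"
    have c1: "cmod c = 1" using False by (simp add: c_def norm_divide)
    have "F (c *\<^sub>C x) = cmod (F x)"
      unfolding hom c_def using False complex_norm_square[of "F x"] 
      by (simp add: field_simps power2_eq_square)
    then have "cmod (F x) = g (c *\<^sub>C x)" by (metis F_def Re_complex_of_real complex.sel(1))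
    also have "\<dots> \<le> K * norm (c *\<^sub>C x)" by (rule bound)
    finally show ?thesis by (simp add: norm_scaleC c1)
  qed
  have bl: "bounded_linear F"
    by (rule bounded_linear_intro[where K = K]) 
       (use add hom bnd in \<open>auto simp: scaleR_scaleC scaleC_complex_def mult.commute\<close>)
  show ?thesis
  proof
    show "Blinfun F \<in> complex_dual" by (simp add: complex_dual_def bounded_linear_Blinfun_apply[OF bl] hom)
    show "Re (blinfun_apply (Blinfun F) x) = g x" for x
      by (simp add: bounded_linear_Blinfun_apply[OF bl] F_def)
    show "norm (Blinfun F) \<le> K"
      using K by (intro norm_blinfun_bound) (simp_all add: bounded_linear_Blinfun_apply[OF bl] bnd)
  qed
qed

lemma complex_dual_separates:
  fixes d :: "'a::complex_normed_vector"
  assumes "\<And>f. f \<in> complex_dual \<Longrightarrow> blinfun_apply f d = 0"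
  shows "d = 0"
proof -
  define C where "C = {t *\<^sub>R d |t. 0 \<le> t}"
  have sl: "sublinear (norm :: 'a \<Rightarrow> real)" by (simp add: sublinear_def norm_triangle_ineq)
  have C0: "0 \<in> C" unfolding C_def by force
  have C1: "c + c' \<in> C" if "c \<in> C" "c' \<in> C" for c c'
    using that unfolding C_def by (force simp flip: scaleR_add_left)
  have C2: "r *\<^sub>R c \<in> C" if "r > 0" "c \<in> C" for r c
    using that unfolding C_def by (force intro: mult_nonneg_nonneg less_imp_le)
  have f1: "norm c + norm c' \<le> norm (c + c')" if "c \<in> C" "c' \<in> C" for c c'
    using that unfolding C_def by (auto simp flip: scaleR_add_left simp: distrib_right)
  have f2: "norm (r *\<^sub>R c) = r * norm c" if "r > 0" "c \<in> C" for r and c :: 'a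
    using that by simp
  obtain g where g: "linear g" "\<And>x. g x \<le> norm x" "\<And>c. c \<in> C \<Longrightarrow> norm c \<le> g c"
    using hahn_banach_cone[of norm C norm, OF sl C0 C1 C2 f1 f2 order_refl] by blast
  have "g x \<le> 1 * norm x" for x using g(2) by simp
  then obtain F where F: "F \<in> complex_dual" "\<And>x. Re (blinfun_apply F x) = g x"
    using complex_dual_of_real[OF g(1) zero_le_one] by metis
  have "d \<in> C" unfolding C_def by (rule CollectI, rule exI[of _ 1]) simp
  then have "norm d \<le> g d" using g(3) by simp
  also have "\<dots> = 0" using F(2)[of d] assms[OF F(1)] by simp
  finally show ?thesis by simp
qed

section \<open>Norming functionals\<close>

lemma scaleC_blinfun_apply [simp]: "blinfun_apply (c *\<^sub>C f) x = c *\<^sub>C blinfun_apply f x"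
  by (simp add: scaleC_blinfun.rep_eq)

lemma complex_dual_apply_scaleC: "f \<in> complex_dual \<Longrightarrow> blinfun_apply f (c *\<^sub>C x) = c * blinfun_apply f x"
  by (simp add: complex_dual_def)

lemma subspace_complex_dual: "complex_vector.subspace complex_dual"
  by (simp add: complex_vector.subspace_def complex_dual_def blinfun.add_left scaleC_complex_def 
      distrib_left)

lemma norming_functionals_subset: "norming_functionals x \<subseteq> complex_dual"
  by (auto simp: norming_functionals_def)

lemma span_norming_functionals_subset: 
  "complex_vector.span (norming_functionals x) \<subseteq> complex_dual"
  by (rule complex_vector.span_minimal[OF norming_functionals_subset subspace_complex_dual])

text \<open>Since \<open>f (x + c d) = 1 + c * f d\<close>, choosing the phase of \<open>c\<close>
  to match \<open>f d\<close> gives a gain of first order, which a norm growing only to second order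
  cannot accommodate.\<close>

lemma norming_functional_zero_tangent:
  assumes f: "f \<in> norming_functionals x"
    and M: "0 \<le> M" "\<And>c. (norm (x + c *\<^sub>C d))\<^sup>2 \<le> 1 + M * (cmod c)\<^sup>2"
  shows "blinfun_apply f d = 0"
proof (rule ccontr)
  define w where "w = blinfun_apply f d"
  assume "blinfun_apply f d \<noteq> 0"
  then have w0: "cmod w > 0" by (simp add: w_def)
  have f': "f \<in> complex_dual" "blinfun_apply f x = 1" "norm f = 1"
    using f by (auto simp: norming_functionals_def)
  \<comment> \<open>Small enough that \<open>M * t < 2\<close>, so the gain
    \<open>2 * t * (cmod w)^2\<close> exceeds the allowance
    \<open>M * (t * cmod w)^2\<close>.\<close>
  define t where "t = 1 / (M + 1)"
  have t: "t > 0" "M * t < 2" using M(1) by (simp_all add: t_def field_simps)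
  define c where "c = complex_of_real t * cnj w"
  have "blinfun_apply f (x + c *\<^sub>C d) = complex_of_real (1 + t * (cmod w)\<^sup>2)"
    using complex_norm_square[of w]
    by (simp add: blinfun.add_right complex_dual_apply_scaleC[OF f'(1)] f'(2) c_def w_def[symmetric] mult_ac)
  then have "1 + t * (cmod w)\<^sup>2 \<le> norm (x + c *\<^sub>C d)"
    using norm_blinfun[of f "x + c *\<^sub>C d"] t(1) f'(3) by (simp add: norm_of_real del: of_real_add)
  then have "(1 + t * (cmod w)\<^sup>2)\<^sup>2 \<le> (norm (x + c *\<^sub>C d))\<^sup>2"
    using t(1) by (intro power_mono) simp_all
  also have "\<dots> \<le> 1 + M * (t * cmod w)\<^sup>2" using M(2)[of c] t(1) by (simp add: c_def norm_mult)
  finally have "1 + 2 * (t * (cmod w)\<^sup>2) + (t * (cmod w)\<^sup>2)\<^sup>2 \<le> 1 + M * (t * cmod w)\<^sup>2"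
    by (simp add: power2_sum algebra_simps)
  moreover have "0 \<le> (t * (cmod w)\<^sup>2)\<^sup>2" by simp
  ultimately have "2 * (t * (cmod w)\<^sup>2) \<le> (M * t) * (t * (cmod w)\<^sup>2)"
    by (simp add: power2_eq_square mult_ac)
  then show False using t w0 by (simp add: mult_le_cancel_right)
qed

lemma norming_functional_apply_mult:
  fixes x :: "'a::cstar_algebra"
  assumes x: "norm x = 1" and f: "f \<in> norming_functionals x"
  shows "blinfun_apply f (a - x * adj x * a) = 0" and "blinfun_apply f (a - a * adj x * x) = 0"
proof -
  show "blinfun_apply f (a - x * adj x * a) = 0"
  proof (rule norming_functional_zero_tangent[OF f])
    show "(norm (x + c *\<^sub>C (a - x * adj x * a)))\<^sup>2 \<le> 1 + (2 * (norm a)\<^sup>2) * (cmod c)\<^sup>2" for c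
      using norm_perturbation_le[of x "c *\<^sub>C a"] x
      by (simp add: scaleC_diff_right mult_scaleC_right norm_scaleC power_mult_distrib mult_ac)
  qed simp
  show "blinfun_apply f (a - a * adj x * x) = 0"
  proof (rule norming_functional_zero_tangent[OF f])
    show "(norm (x + c *\<^sub>C (a - a * adj x * x)))\<^sup>2 \<le> 1 + (2 * (norm a)\<^sup>2) * (cmod c)\<^sup>2" for c
    proof -
      \<comment> \<open>The involution preserves norms and exchanges left and right, so the
        left-hand estimate for \<open>adj x\<close> becomes the right-hand one for
        \<open>x\<close>.\<close>
      have "adj (x + c *\<^sub>C (a - a * adj x * x)) 
          = adj x + (adj (c *\<^sub>C a) - adj x * adj (adj x) * adj (c *\<^sub>C a))"
        by (simp add: adj_scaleC scaleC_diff_right mult_scaleC_right mult.assoc)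
      then have "norm (x + c *\<^sub>C (a - a * adj x * x)) 
          = norm (adj x + (adj (c *\<^sub>C a) - adj x * adj (adj x) * adj (c *\<^sub>C a)))"
        using norm_adj by metis
      then show ?thesis
        using norm_perturbation_le[of "adj x" "adj (c *\<^sub>C a)"] x
        by (simp add: norm_scaleC power_mult_distrib mult_ac del: adj_simps)
    qed
  qed simp
qed

lemma unitary_if_span:
  fixes x :: "'a::cstar_algebra"
  assumes x: "norm x = 1" and span: "complex_vector.span (norming_functionals x) = complex_dual"
  shows "unitary x"
proof -
  have zero: "d = 0" if d: "\<And>f. f \<in> norming_functionals x \<Longrightarrow> blinfun_apply f d = 0" for d
  proof (rule complex_dual_separates)
    fix f :: "'a \<Rightarrow>\<^sub>L complex" assume "f \<in> complex_dual"
    then have "f \<in> complex_vector.span (norming_functionals x)" using span by simp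
    then show "blinfun_apply f d = 0"
    proof (rule complex_vector.span_induct)
      show "complex_vector.subspace {f. blinfun_apply f d = 0}"
        by (simp add: complex_vector.subspace_def blinfun.add_left)
    qed (rule d)
  qed
  have left: "x * adj x * a = a" for a 
    using zero[OF norming_functional_apply_mult(1)[OF x], of a] by simp
  have right: "a * adj x * x = a" for a 
    using zero[OF norming_functional_apply_mult(2)[OF x], of a] by simp
  have "adj (adj a * adj x * x) = a" for a using right[of "adj a"] by simp
  then have left': "adj x * x * a = a" for a by (simp add: mult.assoc)
  have "adj (x * adj x * adj a) = a" for a using left[of "adj a"] by simp
  then have right': "a * (x * adj x) = a" for a by (simp add: mult.assoc)
  have eq: "adj x * x = x * adj x" using right'[of "adj x * x"] left'[of "x * adj x"] by simp
  then have "is_unit_element (x * adj x)"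
    using left right' unfolding is_unit_element_def by blast
  then show ?thesis using eq unfolding unitary_def by blast
qed

section \<open>The norming functionals of the unit span the dual\<close>

text \<open>Positivity controls a real-linear functional on hermitian elements only. Composing with
  this projection discards its values on \<open>\<i>\<close> times hermitian elements before it is
  made complex-linear.\<close>

definition hermitian_part :: "'a::cstar_algebra \<Rightarrow> 'a"
  where "hermitian_part a = (1/2) *\<^sub>R (a + adj a)"

lemma hermitian_part_simps [simp]:
  "adj (hermitian_part a) = hermitian_part a"
  "adj a = a \<Longrightarrow> hermitian_part a = a"
  "adj a = a \<Longrightarrow> hermitian_part (\<i> *\<^sub>C a) = 0"
  by (simp_all add: hermitian_part_def add.commute adj_scaleC complex_vector.scale_minus_left)

lemma linear_hermitian_part: "linear hermitian_part"
  by (rule linearI) (simp_all add: hermitian_part_def algebra_simps)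

lemma norm_hermitian_part_le: "norm (hermitian_part a) \<le> norm a"
  using norm_triangle_ineq[of a "adj a"] by (simp add: hermitian_part_def)

context unital_cstar
begin

text \<open>Hahn--Banach above the superlinear function on the positive cone that takes \<open>u\<close> to the
  supremum of \<open>\<phi>\<close> on the order interval \<open>[0, u]\<close>.\<close>

lemma positive_majorant:
  assumes \<phi>: "linear \<phi>" "\<And>a. \<phi> a \<le> K * norm a" and K: "0 \<le> K"
  obtains g where "linear g" "\<And>u. pos u \<Longrightarrow> 0 \<le> g u" "\<And>u. pos u \<Longrightarrow> \<phi> u \<le> g u"
proof -
  define I where "I u = {w. pos w \<and> pos (u - w)}" for u
  define f where "f u = (SUP w\<in>I u. \<phi> w)" for u
  have ends: "0 \<in> I u" "u \<in> I u" if "pos u" for u using that pos_zero by (simp_all add: I_def)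
  have bd: "\<phi> w \<le> K * norm u" if "w \<in> I u" for w u
  proof -
    have "norm w \<le> norm u" using that pos_minus_norm_mono by (simp add: I_def)
    then have "K * norm w \<le> K * norm u" using K by (rule mult_left_mono)
    then show ?thesis using \<phi>(2)[of w] by linarith
  qed
  have ge: "\<phi> w \<le> f u" if "w \<in> I u" for w u
    unfolding f_def by (rule cSUP_upper) (use that bd in \<open>auto intro!: bdd_aboveI2\<close>)
  have le: "f u \<le> B" if "pos u" "\<And>w. w \<in> I u \<Longrightarrow> \<phi> w \<le> B" for u B
    unfolding f_def by (rule cSUP_least) (use that ends in auto)
  have scale_le: "f (r *\<^sub>R u) \<le> r * f u" if r: "r > 0" and u: "pos u" for r u
  proof (rule le)
    show "pos (r *\<^sub>R u)" using u r by (simp add: pos_scaleR)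
    fix w assume w: "w \<in> I (r *\<^sub>R u)"
    have "(1/r) *\<^sub>R (r *\<^sub>R u - w) = u - (1/r) *\<^sub>R w" using r by (simp add: algebra_simps)
    then have "(1/r) *\<^sub>R w \<in> I u" 
      using w r pos_scaleR[of w "1/r"] pos_scaleR[of "r *\<^sub>R u - w" "1/r"] by (simp add: I_def)
    then have "\<phi> ((1/r) *\<^sub>R w) \<le> f u" by (rule ge)
    then show "\<phi> w \<le> r * f u" using r by (simp add: linear_scale[OF \<phi>(1)] field_simps)
  qed
  have sub: "sublinear (\<lambda>a. K * norm a)"
    unfolding sublinear_def distrib_left[symmetric]
    using K by (auto intro!: mult_left_mono norm_triangle_ineq simp: mult.left_commute)
  have C0: "0 \<in> Collect pos" by (simp add: pos_zero)
  have C1: "c + d \<in> Collect pos" if "c \<in> Collect pos" "d \<in> Collect pos" for c d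
    using that by (simp add: pos_add)
  have C2: "r *\<^sub>R c \<in> Collect pos" if "r > 0" "c \<in> Collect pos" for r c
    using that by (simp add: pos_scaleR)
  \<comment> \<open>Only the inclusion of \<open>[0, c] + [0, d]\<close> in
    \<open>[0, c + d]\<close> enters. The reverse inclusion, the Riesz decomposition, may fail in a
    noncommutative algebra, so \<open>f\<close> is superadditive but perhaps not additive.\<close>
  have f1: "f c + f d \<le> f (c + d)" if cd: "c \<in> Collect pos" "d \<in> Collect pos" for c d
  proof -
    have "f c \<le> f (c + d) - \<phi> w" if w: "w \<in> I d" for w
    proof (rule le)
      show "pos c" using cd by simp
      fix v assume v: "v \<in> I c"
      have eq: "c + d - (v + w) = (c - v) + (d - w)" by simp
      then have "v + w \<in> I (c + d)" 
        using v w unfolding I_def mem_Collect_eq eq by (intro conjI pos_add) simp_all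
      then show "\<phi> v \<le> f (c + d) - \<phi> w" using ge[of "v + w" "c + d"] linear_add[OF \<phi>(1)] by simp
    qed
    then have "f d \<le> f (c + d) - f c" using cd by (intro le) (auto simp: algebra_simps)
    then show ?thesis by simp
  qed
  have f2: "f (r *\<^sub>R c) = r * f c" if r: "r > 0" and c: "c \<in> Collect pos" for r c
  proof (rule antisym[OF scale_le[OF r]])
    have "f ((1/r) *\<^sub>R (r *\<^sub>R c)) \<le> (1/r) * f (r *\<^sub>R c)"
      using r c by (intro scale_le) (simp_all add: pos_scaleR)
    then show "r * f c \<le> f (r *\<^sub>R c)" using r by (simp add: field_simps)
  qed (use c in simp)
  have f3: "f c \<le> K * norm c" if "c \<in> Collect pos" for c using that bd by (intro le) simp_all
  obtain g where g: "linear g" "\<And>c. c \<in> Collect pos \<Longrightarrow> f c \<le> g c"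
    by (rule hahn_banach_cone[of "\<lambda>a. K * norm a" "Collect pos" f, OF sub C0 C1 C2 f1 f2 f3]) blast+
  show ?thesis
  proof
    show "linear g" by (rule g(1))
    show "0 \<le> g u" if "pos u" for u
      using ge[OF ends(1)[OF that]] g(2)[of u] that linear_0[OF \<phi>(1)] by simp
    show "\<phi> u \<le> g u" if "pos u" for u
      using ge[OF ends(2)[OF that]] g(2)[of u] that by simp
  qed
qed

text \<open>Positivity of \<open>norm a e - a\<close> for hermitian \<open>a\<close> bounds
  \<open>g\<close> by \<open>g e\<close> times the norm. Hence the complexification attains its norm
  at \<open>e\<close> and is a nonnegative multiple of a state, or zero.\<close>

lemma positive_functional_in_span:
  assumes g: "linear g" "\<And>u. pos u \<Longrightarrow> 0 \<le> g u"
  obtains F where "F \<in> complex_vector.span (norming_functionals e)"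
    "\<And>a. adj a = a \<Longrightarrow> blinfun_apply F a = complex_of_real (g a)"
proof -
  have lin: "linear (\<lambda>a. g (hermitian_part a))"
    using linear_compose[OF linear_hermitian_part g(1)] by (simp add: o_def)
  have ge: "0 \<le> g e" using g(2) pos_unit by simp
  have bnd: "g (hermitian_part a) \<le> g e * norm a" for a
    using g(2)[OF pos_norm_minus[of "hermitian_part a" "norm a"]] norm_hermitian_part_le[of a]
    by (simp add: linear_diff[OF g(1)] linear_scale[OF g(1)] mult.commute)
  obtain F where F: "F \<in> complex_dual" "\<And>a. Re (blinfun_apply F a) = g (hermitian_part a)" "norm F \<le> g e"
    using complex_dual_of_real[OF lin ge bnd] by blast
  have Fa: "blinfun_apply F a = complex_of_real (g a)" if "adj a = a" for a
  proof -
    have "Re (blinfun_apply F (\<i> *\<^sub>C a)) = 0" using F(2) that linear_0[OF g(1)] by simp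
    then show ?thesis using F(2)[of a] that by (simp add: complex_dual_apply_scaleC[OF F(1)] complex_eq_iff)
  qed
  have nF: "norm F = g e" using F(3) norm_blinfun[of F e] Fa[of e] ge by simp
  have "F \<in> complex_vector.span (norming_functionals e)"
  proof (cases "g e = 0")
    case True
    then show ?thesis using nF complex_vector.span_zero by simp
  next
    case False
    define G where "G = complex_of_real (1 / g e) *\<^sub>C F"
    have "norm G = 1" 
      using nF False ge unfolding G_def scaleR_scaleC[symmetric] by simp
    moreover have "blinfun_apply G e = 1" using Fa[of e] False by (simp add: G_def scaleC_complex_def)
    moreover have "G \<in> complex_dual" 
      unfolding G_def by (rule complex_vector.subspace_scale[OF subspace_complex_dual F(1)])
    ultimately have "G \<in> norming_functionals e" by (simp add: norming_functionals_def)
    then have "complex_of_real (g e) *\<^sub>C G \<in> complex_vector.span (norming_functionals e)"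
      by (intro complex_vector.span_scale complex_vector.span_base)
    moreover have "complex_of_real (g e) *\<^sub>C G = F" 
      using False by (simp add: G_def scaleC_scaleC scaleC_one flip: of_real_mult)
    ultimately show ?thesis by simp
  qed
  then show ?thesis using that Fa by blast
qed

lemma real_functional_in_span:
  assumes \<phi>: "linear \<phi>" "\<And>a. \<phi> a \<le> K * norm a" and K: "0 \<le> K"
  obtains F where "F \<in> complex_vector.span (norming_functionals e)"
    "\<And>a. adj a = a \<Longrightarrow> blinfun_apply F a = complex_of_real (\<phi> a)"
proof -
  obtain g where g: "linear g" "\<And>u. pos u \<Longrightarrow> 0 \<le> g u" "\<And>u. pos u \<Longrightarrow> \<phi> u \<le> g u"
    using positive_majorant[OF assms] by blast
  obtain F where F: "F \<in> complex_vector.span (norming_functionals e)"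
    "\<And>a. adj a = a \<Longrightarrow> blinfun_apply F a = complex_of_real (g a)"
    using positive_functional_in_span[OF g(1,2)] by blast
  have "linear (\<lambda>a. g a - \<phi> a)" by (rule linear_compose_sub[OF g(1) \<phi>(1)])
  moreover have "0 \<le> g u - \<phi> u" if "pos u" for u using g(3)[OF that] by simp
  ultimately obtain H where H: "H \<in> complex_vector.span (norming_functionals e)"
    "\<And>a. adj a = a \<Longrightarrow> blinfun_apply H a = complex_of_real (g a - \<phi> a)"
    using positive_functional_in_span[of "\<lambda>a. g a - \<phi> a"] by blast
  show ?thesis
    by (rule that[of "F - H"]) 
       (simp_all add: complex_vector.span_diff F H blinfun.diff_left)
qed

text \<open>A complex-linear functional is determined by its values on hermitian elements, and there
  its real and imaginary parts can be matched separately by members of the span.\<close>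

lemma span_norming_functionals_unit: "complex_vector.span (norming_functionals e) = complex_dual"
proof (rule antisym[OF span_norming_functionals_subset], rule subsetI)
  fix f :: "'a \<Rightarrow>\<^sub>L complex" assume f: "f \<in> complex_dual"
  have lin: "linear (\<lambda>a. Re (blinfun_apply f a))" "linear (\<lambda>a. Im (blinfun_apply f a))"
    by (rule linearI; simp add: blinfun.add_right blinfun.scaleR_right)+
  have bnd: "Re (blinfun_apply f a) \<le> norm f * norm a" "Im (blinfun_apply f a) \<le> norm f * norm a" for a
    using complex_Re_le_cmod[of "blinfun_apply f a"] abs_Im_le_cmod[of "blinfun_apply f a"] norm_blinfun[of f a] 
    by linarith+
  obtain F where F: "F \<in> complex_vector.span (norming_functionals e)"
    "\<And>a. adj a = a \<Longrightarrow> blinfun_apply F a = complex_of_real (Re (blinfun_apply f a))"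
    using real_functional_in_span[OF lin(1) bnd(1) norm_ge_zero] by blast
  obtain G where G: "G \<in> complex_vector.span (norming_functionals e)"
    "\<And>a. adj a = a \<Longrightarrow> blinfun_apply G a = complex_of_real (Im (blinfun_apply f a))"
    using real_functional_in_span[OF lin(2) bnd(2) norm_ge_zero] by blast
  define h where "h = F + \<i> *\<^sub>C G"
  have hs: "h \<in> complex_vector.span (norming_functionals e)"
    unfolding h_def by (intro complex_vector.span_add complex_vector.span_scale F G)
  then have hd: "h \<in> complex_dual" using span_norming_functionals_subset by blast
  have herm: "blinfun_apply h a = blinfun_apply f a" if "adj a = a" for a
    using F(2)[OF that] G(2)[OF that] by (simp add: h_def blinfun.add_left scaleC_complex_def complex_eq_iff)
  have "h = f"
  proof (rule blinfun_eqI)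
    fix y :: 'a
    obtain a b where "adj a = a" "adj b = b" "y = a + \<i> *\<^sub>C b" using cartesian_decomposition by metis
    then show "blinfun_apply h y = blinfun_apply f y"
      using herm by (simp add: blinfun.add_right complex_dual_apply_scaleC[OF hd] complex_dual_apply_scaleC[OF f])
  qed
  then show "f \<in> complex_vector.span (norming_functionals e)" using hs by simp
qed

end

section \<open>From the unit to an arbitrary unitary\<close>

lemma span_if_unitary:
  fixes x :: "'a::cstar_algebra"
  assumes x: "norm x = 1" and u: "unitary x"
  shows "complex_vector.span (norming_functionals x) = complex_dual"
proof (rule antisym[OF span_norming_functionals_subset], rule subsetI)
  obtain e where e: "is_unit_element e" "adj x * x = e" "x * adj x = e" 
    using u unfolding unitary_def by blast
  interpret unital_cstar e
    by unfold_locales (use e x cstar_identity[of x] in auto)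
  define L where "L y = Blinfun (\<lambda>a. y * a)" for y :: 'a
  have L: "blinfun_apply (L y) a = y * a" for y a
    unfolding L_def by (simp add: bounded_linear_Blinfun_apply bounded_linear_mult_right)
  have dual: "f o\<^sub>L L y \<in> complex_dual" if "f \<in> complex_dual" for f y
    using that by (simp add: complex_dual_def L mult_scaleC_right)
  \<comment> \<open>Composition with multiplication by \<open>adj x\<close> carries norming
    functionals of \<open>e\<close> to norming functionals of \<open>x\<close>, because
    \<open>adj x * x = e\<close> and \<open>adj x\<close> has norm 1. The identity
    \<open>x * adj x = e\<close> makes it surjective on the dual.\<close>
  have translate: "f o\<^sub>L L (adj x) \<in> complex_vector.span (norming_functionals x)" 
    if "f \<in> complex_vector.span (norming_functionals e)" for f
    using that
  proof (rule complex_vector.span_induct)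
    have lin: "(f + g) o\<^sub>L L y = (f o\<^sub>L L y) + (g o\<^sub>L L y)" "(c *\<^sub>C f) o\<^sub>L L y = c *\<^sub>C (f o\<^sub>L L y)"
      "0 o\<^sub>L L y = 0" for f g :: "'a \<Rightarrow>\<^sub>L complex" and c y
      by (rule blinfun_eqI; simp add: blinfun.add_left)+
    show "complex_vector.subspace {f. f o\<^sub>L L (adj x) \<in> complex_vector.span (norming_functionals x)}"
      by (simp add: complex_vector.subspace_def lin complex_vector.span_zero 
          complex_vector.span_add complex_vector.span_scale)
    fix f assume f: "f \<in> norming_functionals e"
    then have f': "f \<in> complex_dual" "blinfun_apply f e = 1" "norm f = 1"
      by (auto simp: norming_functionals_def)
    define h where "h = f o\<^sub>L L (adj x)"
    have hx: "blinfun_apply h x = 1" by (simp add: h_def L e(2) f'(2))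
    have "norm h \<le> 1"
    proof (rule norm_blinfun_bound)
      fix a
      have "norm (blinfun_apply f (adj x * a)) \<le> norm (adj x * a)"
        using norm_blinfun[of f "adj x * a"] f'(3) by simp
      also have "\<dots> \<le> norm a" using norm_mult_ineq[of "adj x" a] x by simp
      finally show "norm (blinfun_apply h a) \<le> 1 * norm a" by (simp add: h_def L)
    qed simp
    moreover have "1 \<le> norm h" using norm_blinfun[of h x] hx x by simp
    ultimately have "h \<in> norming_functionals x"
      using hx dual[OF f'(1)] by (simp add: norming_functionals_def h_def)
    then show "f o\<^sub>L L (adj x) \<in> complex_vector.span (norming_functionals x)"
      unfolding h_def by (rule complex_vector.span_base)
  qed
  fix f :: "'a \<Rightarrow>\<^sub>L complex" assume f: "f \<in> complex_dual"
  have "(f o\<^sub>L L x) o\<^sub>L L (adj x) = f"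
    by (rule blinfun_eqI) (simp add: L e(3) flip: mult.assoc)
  then show "f \<in> complex_vector.span (norming_functionals x)"
    using translate[of "f o\<^sub>L L x"] dual[OF f] span_norming_functionals_unit by simp
qed

theorem theorem2:
  fixes x :: "'a::cstar_algebra"
  assumes "norm x = 1"
  shows "unitary x \<longleftrightarrow> complex_vector.span (norming_functionals x) = complex_dual"
  using unitary_if_span[OF assms] span_if_unitary[OF assms] by blast

end
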